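(* Let $E,V$ be graded vector spaces and $m\oplus\rho$ a degree $+1$ element of $\mathfrak L'=M\oplus R\subset\mathrm{Coder}(\bar S(E\oplus V))$. Then $[m\oplus\rho,m\oplus\rho]_c=0$ if and only if (i) $m^D$ is a Lie $\infty$-algebra structure on $E$ ($(m^D)^2=0$), (ii) $\rho_0^D$ is a Lie $\infty$-algebra structure on $V$ ($(\rho_0^D)^2=0$), and (iii) $x\mapsto\rho^D_x$ is an action of $(E,m^D)$ on $(V,\rho_0^D)$; i.e. $\rho=\sum_{k\ge0}\rho_k$ is a curved Lie $\infty$-action of $(E,m^D)$ on $V$.
   Context: Graded vector spaces are $\mathbb Z$-graded, finite dimensional over $\mathbb R$ or $\mathbb C$, Koszul signs; $\bar S(W)$ is the reduced graded symmetric coalgebra with unshuffle coproduct (Sweedler notation); coderivations of $\bar S(W)$ correspond to linear maps $\bar S(W)\to W$. $M=\mathrm{Hom}(\bar S(E),E)$ and $R=\mathrm{Hom}((\bar S(E)\otimes\bar S(V))\oplus\bar S(V),V)$ are embedded in $\mathrm{Coder}(\bar S(E\oplus V))$ (using $\bar S(E\oplus V)\cong\bar S(E)\oplus(\bar S(E)\otimes\bar S(V))\oplus\bar S(V)$) as the coderivations determined by extending the maps by zero on the remaining components; $[\cdot,\cdot]_c$ is the commutator. $m^D$ is the coderivation of $\bar S(E)$ determined by $m$. For $\rho\in R$, $\rho_0$ is its restriction to $\bar S(V)$ and $\rho_0^D$ the coderivation of $\bar S(V)$ it determines; for $x\in\bar S(E)$, $\rho_x:\bar S(V)\to V$ is $v\mapsto\rho(x\otimes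 v)$ and $\rho^D_x$ the coderivation of $\bar S(V)$ it determines. A Lie $\infty$-algebra structure on $W$ is a degree $+1$ coderivation of $\bar S(W)$ squaring to zero. For a Lie $\infty$-algebra $(V,M_V)$, $\mathrm{Coder}(\bar S(V))[1]$ is the symmetric DGLA with $\partial_{M_V}Q=-M_VQ+(-1)^{\deg Q}QM_V$, $[Q,P]=(-1)^{\deg Q}(QP-(-1)^{\deg Q\deg P}PQ)$; an action of $(E,M_E)$ on $(V,M_V)$ is a degree $+1$ linear map $x\mapsto\Phi_x$, $\bar S(E)\to\mathrm{Coder}(\bar S(V))$, with $\Phi_{M_E(x)}=\partial_{M_V}\Phi_x+\frac12[\Phi_{x_{(1)}},\Phi_{x_{(2)}}]$ for all $x$ (last term $0$ for $x\in E$). A curved Lie $\infty$-action is such an action together with $\Phi_0:=M_V$. *)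

theory Defs
  imports Main
begin

text \<open>
Model. A finite-dimensional graded vector space over a field 'k of characteristic 0 is given
by a finite homogeneous basis, i.e. a finite type 'w together with a degree function
d :: 'w \<Rightarrow> int.  Tensors of T(W) are coordinate functions on words ('w list).
The reduced graded symmetric coalgebra Sbar(W) (unshuffle coproduct) is identified, via the
coalgebra isomorphism x1...xn \<mapsto> sum over sigma of (Koszul sign) x_sigma(1) ... x_sigma(n),
with the graded-symmetric tensors of positive arity inside the deconcatenation coalgebra.
A linear map Sbar(W) \<rightarrow> W is represented by a kernel c :: 'w list \<Rightarrow> 'w \<Rightarrow> 'k
(value of the map on a tensor f at basis vector w is the sum over words v of f v * c v w).
\<close>

definition ksign :: "int \<Rightarrow> 'k::comm_ring_1" where
  "ksign n = (if even n then 1 else -1)"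

definition gdeg :: "('w \<Rightarrow> int) \<Rightarrow> 'w list \<Rightarrow> int" where
  "gdeg d u = sum_list (map d u)"

definition Sbar :: "('w \<Rightarrow> int) \<Rightarrow> ('w list \<Rightarrow> 'k::comm_ring_1) set" where
  "Sbar d = {f. f [] = 0 \<and> finite {u. f u \<noteq> 0} \<and>
      (\<forall>u a b v. f (u @ a # b # v) = ksign (d a * d b) * f (u @ b # a # v))}"

definition homogeneous :: "('w \<Rightarrow> int) \<Rightarrow> int \<Rightarrow> ('w list \<Rightarrow> 'k::zero) \<Rightarrow> bool" where
  "homogeneous d k f \<longleftrightarrow> (\<forall>u. f u \<noteq> 0 \<longrightarrow> gdeg d u = k)"

text \<open>The coderivation of Sbar(W) determined by the degree-n linear map Sbar(W) \<rightarrow> W with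
kernel c: on words it is the sum of id^p \<otimes> c \<otimes> id^s with the Koszul sign.\<close>
definition coder :: "('w \<Rightarrow> int) \<Rightarrow> int \<Rightarrow> ('w list \<Rightarrow> 'w \<Rightarrow> 'k::comm_ring_1)
    \<Rightarrow> ('w list \<Rightarrow> 'k) \<Rightarrow> ('w list \<Rightarrow> 'k)" where
  "coder d n c f t =
     (\<Sum>(p, w, s) \<in> {(p, w, s). t = p @ [w] @ s}.
        \<Sum>v \<in> {v. v \<noteq> [] \<and> f (p @ v @ s) \<noteq> 0}.
          ksign (n * gdeg d p) * f (p @ v @ s) * c v w)"

definition ccomm :: "int \<Rightarrow> (('w list \<Rightarrow> 'k) \<Rightarrow> ('w list \<Rightarrow> 'k)) \<Rightarrow> int
    \<Rightarrow> (('w list \<Rightarrow> 'k) \<Rightarrow> ('w list \<Rightarrow> 'k)) \<Rightarrow> ('w list \<Rightarrow> 'k::comm_ring_1) \<Rightarrow> ('w list \<Rightarrow> 'k)" where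
  "ccomm n1 D1 n2 D2 f = (\<lambda>t. D1 (D2 f) t - ksign (n1 * n2) * D2 (D1 f) t)"

definition sumdeg :: "('e \<Rightarrow> int) \<Rightarrow> ('v \<Rightarrow> int) \<Rightarrow> 'e + 'v \<Rightarrow> int" where
  "sumdeg dE dV z = (case z of Inl e \<Rightarrow> dE e | Inr v \<Rightarrow> dV v)"

text \<open>Kernel of m \<oplus> \<rho> on Sbar(E \<oplus> V), extended by zero.  m :: Hom(Sbar E, E) has kernel m;
\<rho> :: Hom((Sbar E \<otimes> Sbar V) \<oplus> Sbar V, V) has kernel r a b w (a = [] encodes the Sbar V
summand).  Under Sbar(E\<oplus>V) \<cong> Sbar E \<oplus> (Sbar E \<otimes> Sbar V) \<oplus> Sbar V, the components of a
symmetric tensor are its restrictions to words of the form (E-word), (E-word)(V-word), (V-word).\<close>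
definition Kmr :: "('e list \<Rightarrow> 'e \<Rightarrow> 'k::zero) \<Rightarrow> ('e list \<Rightarrow> 'v list \<Rightarrow> 'v \<Rightarrow> 'k)
    \<Rightarrow> ('e + 'v) list \<Rightarrow> 'e + 'v \<Rightarrow> 'k" where
  "Kmr m r t z = (case z of
      Inl e \<Rightarrow> (if t \<noteq> [] \<and> list_all isl t then m (map projl t) e else 0)
    | Inr w \<Rightarrow> (let a = takeWhile isl t; b = dropWhile isl t in
                 if b \<noteq> [] \<and> list_all (\<lambda>y. \<not> isl y) b
                 then r (map projl a) (map projr b) w else 0))"

definition rho_at :: "('e list \<Rightarrow> 'v list \<Rightarrow> 'v \<Rightarrow> 'k::comm_ring_1) \<Rightarrow> ('e list \<Rightarrow> 'k)
    \<Rightarrow> 'v list \<Rightarrow> 'v \<Rightarrow> 'k" where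
  "rho_at r x b w = (\<Sum>a \<in> {a. x a \<noteq> 0}. x a * r a b w)"

definition lie_infty :: "('w \<Rightarrow> int) \<Rightarrow> (('w list \<Rightarrow> 'k) \<Rightarrow> ('w list \<Rightarrow> 'k::comm_ring_1)) \<Rightarrow> bool" where
  "lie_infty d Q \<longleftrightarrow> (\<forall>f \<in> Sbar d. Q (Q f) = (\<lambda>_. 0))"

text \<open>Action of (E, M_E) on (V, M_V) given by x \<mapsto> \<Phi>_x = coderivation of Sbar V determined by
\<rho>_x (degree deg x + 1):
  \<Phi>_{M_E x} = \<partial>_{M_V} \<Phi>_x + 1/2 [\<Phi>_{x(1)}, \<Phi>_{x(2)}]   for all homogeneous x \<in> Sbar E,
with \<partial>_{M_V} Q = - M_V Q + (-1)^{deg Q} Q M_V, [Q,P] = (-1)^{deg Q}(QP - (-1)^{deg Q deg P} PQ),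
and x(1) \<otimes> x(2) the reduced (unshuffle) coproduct, i.e. the sum over u, v nonempty of
x(u @ v) e_u \<otimes> e_v.\<close>
definition is_action :: "('e \<Rightarrow> int) \<Rightarrow> ('v \<Rightarrow> int)
    \<Rightarrow> (('e list \<Rightarrow> 'k) \<Rightarrow> ('e list \<Rightarrow> 'k)) \<Rightarrow> (('v list \<Rightarrow> 'k) \<Rightarrow> ('v list \<Rightarrow> 'k))
    \<Rightarrow> ('e list \<Rightarrow> 'v list \<Rightarrow> 'v \<Rightarrow> 'k::field_char_0) \<Rightarrow> bool" where
  "is_action dE dV ME MV r \<longleftrightarrow>
    (\<forall>k x. x \<in> Sbar dE \<longrightarrow> homogeneous dE k x \<longrightarrow> (\<forall>g \<in> Sbar dV.
       (let Phi = (\<lambda>y n. coder dV n (rho_at r y));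
            Phiw = (\<lambda>u. coder dV (gdeg dE u + 1) (r u))
        in Phi (ME x) (k + 2) g =
           (\<lambda>t. - MV (Phi x (k + 1) g) t + ksign (k + 1) * Phi x (k + 1) (MV g) t
              + (1/2) * (\<Sum>s \<in> {s. x s \<noteq> 0}.
                   \<Sum>(u, v) \<in> {(u, v). s = u @ v \<and> u \<noteq> [] \<and> v \<noteq> []}.
                     x s * ksign (gdeg dE u + 1) *
                       ccomm (gdeg dE u + 1) (Phiw u) (gdeg dE v + 1) (Phiw v) g t)))))"

end

(* A coderivation is determined by its corestriction, and the commutator of two homogeneous
   coderivations is again a coderivation; so all three conditions on the right and the one on the
   left need only be tested on one-letter components.  Since m+rho is degree 1, its self-commutator
   is twice its square Q Q.  The E-component of Q Q f only involves the restriction of f to words in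
   E and is the corresponding component of m^D m^D.  The V-component depends linearly on the
   restriction F(a,b) = f(ab) to words a in E followed by words b in V.  For F = x (tensor) g it is
     rho_{m^D x}(g) + sum (+-) x(ac) rho_a(rho_c^D(g)),
   a and c possibly empty: for x = 1 this is the component of (rho_0^D)^2 g, and for x in Sbar(E) it
   is the defect in the action equation, the factor 1/2 there being absorbed by the graded symmetry
   of x.  Every F is a finite sum of such tensors, and every such tensor extends to a symmetric f. *)

theory Submission
  imports Defs
begin

section \<open>Signs and words of bounded length\<close>

lemma ksign_add: "ksign (a + b) = ksign a * ksign b"
  by (simp add: ksign_def)

lemma ksign_square_left [simp]: "ksign a * (ksign a * x) = x"
  by (simp add: ksign_def)

lemma ksign_0 [simp]: "ksign 0 = 1"
  by (simp add: ksign_def)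

lemma gdeg_Nil [simp]: "gdeg d [] = 0"
  by (simp add: gdeg_def)

lemma gdeg_Cons [simp]: "gdeg d (a # u) = d a + gdeg d u"
  by (simp add: gdeg_def)

lemma gdeg_append [simp]: "gdeg d (u @ v) = gdeg d u + gdeg d v"
  by (simp add: gdeg_def)

definition words :: "nat \<Rightarrow> 'w list set" where
  "words N = {u. length u \<le> N}"

definition pwords :: "nat \<Rightarrow> 'w list set" where
  "pwords N = {u. u \<noteq> [] \<and> length u \<le> N}"

text \<open>A common length bound for all tensors in play lets every sum run over one fixed finite
  set of words, so sums can be interchanged without following supports. Over a finite alphabet this
  amounts to finite support.\<close>

definition bounded_by :: "nat \<Rightarrow> ('w list \<Rightarrow> 'k::zero) \<Rightarrow> bool" where
  "bounded_by N f \<longleftrightarrow> (\<forall>u. N < length u \<longrightarrow> f u = 0)"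

lemma finite_words [simp]: "finite (words N :: 'w::finite list set)"
  using finite_lists_length_le[of "UNIV :: 'w set" N] by (simp add: words_def)

lemma pwords_subset_words: "pwords N \<subseteq> words N"
  by (auto simp: words_def pwords_def)

lemma finite_pwords [simp]: "finite (pwords N :: 'w::finite list set)"
  using finite_subset[OF pwords_subset_words finite_words] .

lemma words_eq_insert: "words N = insert [] (pwords N)"
  by (auto simp: words_def pwords_def)

lemma Nil_notin_pwords [simp]: "[] \<notin> pwords N"
  by (simp add: pwords_def)

lemma sum_words:
  "sum h (words N :: 'w::finite list set) = h [] + sum h (pwords N)"
  by (simp add: words_eq_insert)

lemma bounded_by_nonzero: "bounded_by N f \<Longrightarrow> f u \<noteq> 0 \<Longrightarrow> u \<in> words N"
  by (force simp: bounded_by_def words_def)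

lemma bounded_by_mono: "bounded_by N f \<Longrightarrow> N \<le> M \<Longrightarrow> bounded_by M f"
  by (auto simp: bounded_by_def)

lemma finite_support_iff_bounded_by:
  "finite {u :: 'w::finite list. f u \<noteq> 0} \<longleftrightarrow> (\<exists>N. bounded_by N f)"
proof
  assume fin: "finite {u. f u \<noteq> 0}"
  have "bounded_by (Max (insert 0 (length ` {u. f u \<noteq> 0}))) f"
    unfolding bounded_by_def
  proof (intro allI impI, rule ccontr)
    fix u assume u: "Max (insert 0 (length ` {u. f u \<noteq> 0})) < length u" "f u \<noteq> 0"
    have "length u \<le> Max (insert 0 (length ` {u. f u \<noteq> 0}))"
      using fin u(2) by (intro Max_ge) auto
    with u(1) show False by simp
  qed
  then show "\<exists>N. bounded_by N f" ..
next
  assume "\<exists>N. bounded_by N f"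
  then obtain N where "bounded_by N f" ..
  then have "{u. f u \<noteq> 0} \<subseteq> words N" using bounded_by_nonzero by blast
  then show "finite {u. f u \<noteq> 0}" by (rule finite_subset) simp
qed

text \<open>The symmetry clause of \<open>Sbar\<close> on its own: slices of a symmetric tensor and
  the unit tensor satisfy it, although they may be nonzero on the empty word.\<close>

definition graded_symmetric :: "('w \<Rightarrow> int) \<Rightarrow> ('w list \<Rightarrow> 'k::comm_ring_1) \<Rightarrow> bool" where
  "graded_symmetric d f \<longleftrightarrow>
     (\<forall>u a b v. f (u @ a # b # v) = ksign (d a * d b) * f (u @ b # a # v))"

lemma graded_symmetricD:
  "graded_symmetric d f \<Longrightarrow> f (u @ a # b # v) = ksign (d a * d b) * f (u @ b # a # v)"
  unfolding graded_symmetric_def by blast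

lemma Sbar_iff:
  fixes d :: "'w::finite \<Rightarrow> int"
  shows "f \<in> Sbar d \<longleftrightarrow> f [] = 0 \<and> (\<exists>N. bounded_by N f) \<and> graded_symmetric d f"
  unfolding Sbar_def graded_symmetric_def by (simp add: finite_support_iff_bounded_by)

lemma graded_symmetric_slice:
  assumes "graded_symmetric d f"
  shows "graded_symmetric d (\<lambda>u. f (p @ u @ s))"
  unfolding graded_symmetric_def
proof (intro allI)
  fix u a b v
  show "f (p @ (u @ a # b # v) @ s) = ksign (d a * d b) * f (p @ (u @ b # a # v) @ s)"
    using graded_symmetricD[OF assms, of "p @ u" a b "v @ s"] by simp
qed

lemma graded_symmetric_upd_Nil:
  assumes "graded_symmetric d f"
  shows "graded_symmetric d (f([] := q))"
  unfolding graded_symmetric_def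
proof (intro allI)
  fix u a b v
  show "(f([] := q)) (u @ a # b # v) = ksign (d a * d b) * (f([] := q)) (u @ b # a # v)"
    using graded_symmetricD[OF assms, of u a b v] by simp
qed

lemma graded_symmetric_diff:
  assumes x: "graded_symmetric d x" and y: "graded_symmetric d y"
  shows "graded_symmetric d (\<lambda>u. x u - q * y u)"
  unfolding graded_symmetric_def
proof (intro allI)
  fix u a b v
  show "x (u @ a # b # v) - q * y (u @ a # b # v)
      = ksign (d a * d b) * (x (u @ b # a # v) - q * y (u @ b # a # v))"
    using graded_symmetricD[OF x, of u a b v] graded_symmetricD[OF y, of u a b v]
    by (simp add: algebra_simps)
qed

lemma graded_symmetric_move_letter:
  assumes "graded_symmetric d f"
  shows "f (u @ b # c @ v) = ksign (d b * gdeg d c) * f (u @ c @ b # v)"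
proof (induction c arbitrary: u)
  case (Cons e c)
  have "f (u @ b # (e # c) @ v) = ksign (d b * d e) * f ((u @ [e]) @ b # c @ v)"
    using graded_symmetricD[OF assms, of u b e "c @ v"] by simp
  also have "\<dots> = ksign (d b * gdeg d (e # c)) * f (u @ (e # c) @ b # v)"
    using Cons.IH[of "u @ [e]"] by (simp add: ksign_add distrib_left mult.assoc)
  finally show ?case .
qed simp

lemma bounded_by_slice:
  "bounded_by N f \<Longrightarrow> bounded_by N (\<lambda>u. f (p @ u @ s))"
  by (simp add: bounded_by_def)

lemma bounded_by_upd_Nil:
  "bounded_by N f \<Longrightarrow> bounded_by N (f([] := q))"
  by (simp add: bounded_by_def)

text \<open>Fixing a prefix and a suffix leaves the symmetry in the middle intact. The slice takes
  the value \<open>f (p @ s)\<close> on the empty word, which is reset to 0; \<open>cod\<close> does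
  not see that value.\<close>

lemma Sbar_slice:
  fixes d :: "'w::finite \<Rightarrow> int"
  assumes "f \<in> Sbar d"
  shows "(\<lambda>u. f (p @ u @ s))([] := 0) \<in> Sbar d"
  using assms unfolding Sbar_iff
  by (auto intro!: graded_symmetric_upd_Nil graded_symmetric_slice
           dest: bounded_by_slice[THEN bounded_by_upd_Nil])

section \<open>Coderivations of the tensor coalgebra\<close>

text \<open>The operator \<^const>\<open>coder\<close> with its inner sum taken over a fixed finite set of words, so that it
is linear on all functions; the two agree on functions supported on words of length at most
\<open>N\<close>.\<close>

fun cod :: "nat \<Rightarrow> ('w \<Rightarrow> int) \<Rightarrow> int \<Rightarrow> ('w list \<Rightarrow> 'w \<Rightarrow> 'k::comm_ring_1)
    \<Rightarrow> ('w list \<Rightarrow> 'k) \<Rightarrow> ('w list \<Rightarrow> 'k)" where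
  "cod N d n c f [] = 0"
| "cod N d n c f (z # t) =
     (\<Sum>v\<in>pwords N. f (v @ t) * c v z) + ksign (n * d z) * cod N d n c (\<lambda>u. f (z # u)) t"

lemma finite_splits: "finite {(p, w, s). t = p @ [w] @ s}"
proof -
  have "{(p, w, s). t = p @ [w] @ s} \<subseteq>
      (\<lambda>i. (take i t, t ! i, drop (Suc i) t)) ` {..length t}"
  proof clarify
    fix p w s assume "t = p @ [w] @ s"
    then show "(p, w, s) \<in> (\<lambda>i. (take i (p @ [w] @ s), (p @ [w] @ s) ! i,
        drop (Suc i) (p @ [w] @ s))) ` {..length (p @ [w] @ s)}"
      by (intro image_eqI[of _ _ "length p"]) auto
  qed
  then show ?thesis by (rule finite_subset) simp
qed

lemma splits_Cons:
  "{(p, w, s). z # t = p @ [w] @ s} =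
     insert ([], z, t) ((\<lambda>(p, w, s). (z # p, w, s)) ` {(p, w, s). t = p @ [w] @ s})"
  by (auto simp: Cons_eq_append_conv image_iff)

text \<open>Positions in \<open>z # t\<close> are either the first one, giving the first summand of
  \<open>cod\<close>, or lie in \<open>t\<close>, where \<open>z\<close> joins the prefix and
  contributes its Koszul sign. The bound on \<open>f\<close> confines the inserted words to
  \<open>pwords N\<close>.\<close>

lemma coder_eq_cod:
  fixes d :: "'w::finite \<Rightarrow> int"
  assumes "bounded_by N f"
  shows "coder d n c f = cod N d n c f"
proof
  fix t
  have restrict: "(\<Sum>v\<in>{v. v \<noteq> [] \<and> f (p @ v @ s) \<noteq> 0}. ksign (n * gdeg d p) * f (p @ v @ s) * c v w)
      = (\<Sum>v\<in>pwords N. ksign (n * gdeg d p) * f (p @ v @ s) * c v w)"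
    if "bounded_by N f" for f :: "'w list \<Rightarrow> 'a" and p s w
    using bounded_by_nonzero[OF bounded_by_slice[OF that, of p s]]
    by (intro sum.mono_neutral_left finite_pwords) (auto simp: words_def pwords_def)
  have coder_eq: "coder d n c f t = (\<Sum>(p, w, s) \<in> {(p, w, s). t = p @ [w] @ s}.
        \<Sum>v\<in>pwords N. ksign (n * gdeg d p) * f (p @ v @ s) * c v w)"
    if "bounded_by N f" for f t
    unfolding coder_def by (simp add: restrict[OF that])
  show "coder d n c f t = cod N d n c f t"
    using assms
  proof (induction t arbitrary: f)
    case Nil
    show ?case unfolding coder_def cod.simps by (rule sum.neutral) auto
  next
    case (Cons z t)
    have b: "bounded_by N (\<lambda>u. f (z # u))"
      using bounded_by_slice[OF Cons.prems, of "[z]" "[]"] by simp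
    have "coder d n c f (z # t) = (\<Sum>v\<in>pwords N. f (v @ t) * c v z) +
       (\<Sum>(p, w, s) \<in> {(p, w, s). t = p @ [w] @ s}.
        \<Sum>v\<in>pwords N. ksign (n * gdeg d (z # p)) * f (z # p @ v @ s) * c v w)"
      unfolding coder_eq[OF Cons.prems] splits_Cons
      by (subst sum.insert)
         (use finite_splits[of t] in
           \<open>auto simp: sum.reindex inj_on_def case_prod_unfold\<close>)
    also have "(\<Sum>(p, w, s) \<in> {(p, w, s). t = p @ [w] @ s}.
        \<Sum>v\<in>pwords N. ksign (n * gdeg d (z # p)) * f (z # p @ v @ s) * c v w)
        = ksign (n * d z) * coder d n c (\<lambda>u. f (z # u)) t"
      unfolding coder_eq[OF b]
      by (simp add: sum_distrib_left case_prod_unfold distrib_left ksign_add mult.assoc)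
    finally show ?case by (simp add: Cons.IH[OF b])
  qed
qed

section \<open>Linearity of \<open>cod\<close> and its effect on supports\<close>

lemma cod_sum:
  "cod N d n c (\<lambda>u. \<Sum>i\<in>I. q i * f i u) t = (\<Sum>i\<in>I. q i * cod N d n c (f i) t)"
proof (induction t arbitrary: f)
  case (Cons z t)
  have "(\<Sum>v\<in>pwords N. (\<Sum>i\<in>I. q i * f i (v @ t)) * c v z)
      = (\<Sum>i\<in>I. q i * (\<Sum>v\<in>pwords N. f i (v @ t) * c v z))"
    unfolding sum_distrib_right sum_distrib_left
    by (subst sum.swap) (simp add: mult.assoc)
  then show ?case
    by (simp add: Cons.IH distrib_left sum.distrib sum_distrib_left mult.left_commute)
qed simp

lemma cod_add: "cod N d n c (\<lambda>u. f u + g u) t = cod N d n c f t + cod N d n c g t"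
  by (induction t arbitrary: f g) (simp_all add: distrib_right distrib_left sum.distrib)

lemma cod_scale: "cod N d n c (\<lambda>u. q * f u) t = q * cod N d n c f t"
  using cod_sum[of N d n c "\<lambda>_. q" "\<lambda>_. f" "{()}" t] by simp

lemma cod_zero: "cod N d n c (\<lambda>u. 0) t = 0"
  using cod_scale[of N d n c 0 "\<lambda>_. 0" t] by simp

lemma cod_kernel_sum:
  "cod N d n (\<lambda>v w. \<Sum>i\<in>I. q i * c i v w) f t = (\<Sum>i\<in>I. q i * cod N d n (c i) f t)"
proof (induction t arbitrary: f)
  case (Cons z t)
  have "(\<Sum>v\<in>pwords N. f (v @ t) * (\<Sum>i\<in>I. q i * c i v z))
      = (\<Sum>i\<in>I. q i * (\<Sum>v\<in>pwords N. f (v @ t) * c i v z))"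
    unfolding sum_distrib_left by (subst sum.swap) (simp add: mult.left_commute)
  then show ?case
    by (simp add: Cons.IH distrib_left sum.distrib sum_distrib_left mult.left_commute)
qed simp

text \<open>A letter is always replaced by a nonempty word, so the argument is never evaluated on
  the empty word.\<close>

lemma cod_cong_nonempty:
  "(\<And>u. u \<noteq> [] \<Longrightarrow> f u = g u) \<Longrightarrow> cod N d n c f t = cod N d n c g t"
proof (induction t arbitrary: f g)
  case (Cons z t)
  have "(\<Sum>v\<in>pwords N. f (v @ t) * c v z) = (\<Sum>v\<in>pwords N. g (v @ t) * c v z)"
    by (rule sum.cong) (auto simp: pwords_def Cons.prems)
  moreover have "cod N d n c (\<lambda>u. f (z # u)) t = cod N d n c (\<lambda>u. g (z # u)) t"
    by (rule Cons.IH) (simp add: Cons.prems)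
  ultimately show ?case by simp
qed simp

lemma cod_upd_Nil: "cod N d n c (f([] := q)) = cod N d n c f"
  by (rule ext, rule cod_cong_nonempty) simp

text \<open>The words looked up by \<open>cod\<close> at \<open>t\<close> are at least as long as
  \<open>t\<close>. Hence the same \<open>N\<close> serves for composites.\<close>

lemma bounded_by_cod:
  fixes f :: "'w list \<Rightarrow> 'k::comm_ring_1"
  assumes "bounded_by M f"
  shows "bounded_by M (cod N d n c f)"
  unfolding bounded_by_def
proof (intro allI impI)
  fix t :: "'w list" assume "M < length t"
  then show "cod N d n c f t = 0"
    using assms
  proof (induction t arbitrary: f M)
    case (Cons z t)
    have "f (v @ t) = 0" if "v \<in> pwords N" for v
    proof -
      have "Suc 0 \<le> length v" using that by (cases v) (auto simp: pwords_def)
      then show ?thesis using Cons.prems unfolding bounded_by_def by simp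
    qed
    moreover have "cod N d n c (\<lambda>u. f (z # u)) t = 0"
    \<comment> \<open>Removing the first letter lowers the bound by one; for bound 0 the slice
      vanishes altogether.\<close>
    proof (cases M)
      case 0
      then have "(\<lambda>u. f (z # u)) = (\<lambda>u. 0)" using Cons.prems(2) by (auto simp: bounded_by_def)
      then show ?thesis by (simp add: cod_zero)
    next
      case (Suc M')
      show ?thesis
        by (rule Cons.IH[of M']) (use Cons.prems Suc in \<open>auto simp: bounded_by_def\<close>)
    qed
    ultimately show ?case by simp
  qed simp
qed

text \<open>Iterating the second equation shows that \<open>G\<close> is determined by its one-letter components.\<close>

definition coderivation :: "('w \<Rightarrow> int) \<Rightarrow> int
    \<Rightarrow> (('w list \<Rightarrow> 'k::comm_ring_1) \<Rightarrow> ('w list \<Rightarrow> 'k)) \<Rightarrow> bool" where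
  "coderivation d k G \<longleftrightarrow>
     (\<forall>f. G f [] = 0) \<and>
     (\<forall>f z t. G f (z # t) = G (\<lambda>u. f (u @ t)) [z] + ksign (k * d z) * G (\<lambda>u. f (z # u)) t)"

lemma coderivation_Nil: "coderivation d k G \<Longrightarrow> G f [] = 0"
  by (simp add: coderivation_def)

lemma coderivation_Cons:
  "coderivation d k G \<Longrightarrow>
     G f (z # t) = G (\<lambda>u. f (u @ t)) [z] + ksign (k * d z) * G (\<lambda>u. f (z # u)) t"
  unfolding coderivation_def by blast

lemma coderivation_append:
  assumes G: "coderivation d k G"
  shows "G f (v @ t) = G (\<lambda>u. f (u @ t)) v + ksign (k * gdeg d v) * G (\<lambda>u. f (v @ u)) t"
proof (induction v arbitrary: f)
  case Nil
  then show ?case by (simp add: coderivation_Nil[OF G])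
next
  case (Cons z v)
  have "G f ((z # v) @ t) = G (\<lambda>u. f (u @ v @ t)) [z] + ksign (k * d z) * G (\<lambda>u. f (z # u)) (v @ t)"
    using coderivation_Cons[OF G, of f z "v @ t"] by simp
  also have "G (\<lambda>u. f (z # u)) (v @ t) =
      G (\<lambda>u. f (z # u @ t)) v + ksign (k * gdeg d v) * G (\<lambda>u. f (z # v @ u)) t"
    by (rule Cons.IH)
  finally show ?case
    using coderivation_Cons[OF G, of "\<lambda>u. f (u @ t)" z v]
    by (simp add: distrib_left ksign_add mult.assoc add.assoc)
qed

lemma coderivation_cod: "coderivation d n (cod N d n c)"
  by (simp add: coderivation_def)

lemma coderivationI:
  assumes "\<And>f. G f [] = 0"
    and "\<And>f z t. G f (z # t) = G (\<lambda>u. f (u @ t)) [z] + ksign (k * d z) * G (\<lambda>u. f (z # u)) t"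
  shows "coderivation d k G"
  unfolding coderivation_def using assms by blast

lemma coderivation_add:
  assumes G: "coderivation d k G" and H: "coderivation d k H"
  shows "coderivation d k (\<lambda>f t. G f t + H f t)"
proof (rule coderivationI)
  fix f z t
  show "G f (z # t) + H f (z # t) = G (\<lambda>u. f (u @ t)) [z] + H (\<lambda>u. f (u @ t)) [z]
      + ksign (k * d z) * (G (\<lambda>u. f (z # u)) t + H (\<lambda>u. f (z # u)) t)"
    unfolding coderivation_Cons[OF G, of f z t] coderivation_Cons[OF H, of f z t]
    by (simp only: distrib_left ac_simps)
qed (simp add: coderivation_Nil[OF G] coderivation_Nil[OF H])

lemma coderivation_scale:
  assumes G: "coderivation d k G"
  shows "coderivation d k (\<lambda>f t. q * G f t)"
proof (rule coderivationI)
  fix f z t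
  show "q * G f (z # t) = q * G (\<lambda>u. f (u @ t)) [z]
      + ksign (k * d z) * (q * G (\<lambda>u. f (z # u)) t)"
    unfolding coderivation_Cons[OF G, of f z t]
    by (simp only: distrib_left mult.left_commute)
qed (simp add: coderivation_Nil[OF G])

lemma coderivation_sum:
  assumes "\<And>i. i \<in> I \<Longrightarrow> coderivation d k (G i)"
  shows "coderivation d k (\<lambda>f t. \<Sum>i\<in>I. G i f t)"
proof (rule coderivationI)
  fix f z t
  show "(\<Sum>i\<in>I. G i f (z # t)) = (\<Sum>i\<in>I. G i (\<lambda>u. f (u @ t)) [z]) +
      ksign (k * d z) * (\<Sum>i\<in>I. G i (\<lambda>u. f (z # u)) t)"
    unfolding sum_distrib_left sum.distrib[symmetric]
    by (rule sum.cong) (auto intro: coderivation_Cons assms)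
qed (simp add: coderivation_Nil[OF assms])

section \<open>Graded commutators of coderivations and the one-letter criterion\<close>

definition kernel_degree :: "('w \<Rightarrow> int) \<Rightarrow> int \<Rightarrow> ('w list \<Rightarrow> 'w \<Rightarrow> 'k::zero) \<Rightarrow> bool" where
  "kernel_degree d n c \<longleftrightarrow> (\<forall>v w. v \<noteq> [] \<longrightarrow> c v w \<noteq> 0 \<longrightarrow> d w = gdeg d v + n)"

text \<open>Besides the two coderivation terms, the composite contains the terms in which both kernels act
on disjoint parts of the word.\<close>

lemma cod_cod_Cons:
  "cod N d n c (cod N d n' c' f) (z # t) =
     cod N d n c (cod N d n' c' (\<lambda>u. f (u @ t))) [z]
     + (\<Sum>v\<in>pwords N. ksign (n' * gdeg d v) * c v z * cod N d n' c' (\<lambda>u. f (v @ u)) t)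
     + (\<Sum>v\<in>pwords N. ksign (n * d z) * c' v z * cod N d n c (\<lambda>u. f (v @ u)) t)
     + ksign ((n + n') * d z) * cod N d n c (cod N d n' c' (\<lambda>u. f (z # u))) t"
proof -
  \<comment> \<open>The outer kernel produces the first letter \<open>z\<close> from
    \<open>v\<close>; the inner operator then acts either on \<open>v\<close> or on the remaining
    word \<open>t\<close>.\<close>
  have 1: "(\<Sum>v\<in>pwords N. cod N d n' c' f (v @ t) * c v z) =
      cod N d n c (cod N d n' c' (\<lambda>u. f (u @ t))) [z]
      + (\<Sum>v\<in>pwords N. ksign (n' * gdeg d v) * c v z * cod N d n' c' (\<lambda>u. f (v @ u)) t)"
    unfolding coderivation_append[OF coderivation_cod, of N d n' c' f]
    by (simp add: distrib_left distrib_right sum.distrib mult_ac)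
  \<comment> \<open>The outer operator acts on \<open>t\<close>; the inner one then either produces
    \<open>z\<close> or passes over it.\<close>
  have "cod N d n c (\<lambda>u. cod N d n' c' f (z # u)) t =
      cod N d n c (\<lambda>u. (\<Sum>v\<in>pwords N. c' v z * f (v @ u))
        + ksign (n' * d z) * cod N d n' c' (\<lambda>u. f (z # u)) u) t"
    by (simp add: mult.commute)
  also have "\<dots> = (\<Sum>v\<in>pwords N. c' v z * cod N d n c (\<lambda>u. f (v @ u)) t)
      + ksign (n' * d z) * cod N d n c (cod N d n' c' (\<lambda>u. f (z # u))) t"
    unfolding cod_add cod_sum cod_scale ..
  finally have 2: "ksign (n * d z) * cod N d n c (\<lambda>u. cod N d n' c' f (z # u)) t =
      (\<Sum>v\<in>pwords N. ksign (n * d z) * c' v z * cod N d n c (\<lambda>u. f (v @ u)) t)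
      + ksign ((n + n') * d z) * cod N d n c (cod N d n' c' (\<lambda>u. f (z # u))) t"
    by (simp add: distrib_left distrib_right ksign_add sum_distrib_left mult.assoc)
  show ?thesis
    using 1 2 by simp
qed

text \<open>The terms of \<open>cod_cod_Cons\<close> in which the two kernels act on disjoint parts
  occur in both orders of composition and cancel, once signs in the degree of \<open>v\<close> are
  rewritten in the degree of \<open>z\<close>.\<close>

lemma coderivation_ccomm:
  assumes c: "kernel_degree d n c" and c': "kernel_degree d n' c'"
  shows "coderivation d (n + n') (ccomm n (cod N d n c) n' (cod N d n' c'))"
proof -
  have sgn: "ksign (b * v) * k = ksign (a * b) * (ksign (b * z) * k)"
    if "k \<noteq> 0 \<Longrightarrow> z = v + a" for a b v z :: int and k :: 'b
    using that by (cases "k = 0") (auto simp: ksign_def)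
  \<comment> \<open>Where the kernel is nonzero, its degree fixes \<open>gdeg d v\<close> in terms
    of \<open>d z\<close>; elsewhere the summand vanishes.\<close>
  have cross: "(\<Sum>v\<in>pwords N. ksign (b * gdeg d v) * h v z * H v)
      = ksign (a * b) * (\<Sum>v\<in>pwords N. ksign (b * d z) * h v z * H v)"
    if "kernel_degree d a h" for a b h z and H :: "'a list \<Rightarrow> 'b"
    unfolding sum_distrib_left mult.assoc[symmetric]
  proof (rule sum.cong[OF refl])
    fix v :: "'a list" assume "v \<in> pwords N"
    then have "h v z \<noteq> 0 \<Longrightarrow> d z = gdeg d v + a"
      using that by (simp add: kernel_degree_def pwords_def)
    then show "ksign (b * gdeg d v) * h v z * H v = ksign (a * b) * ksign (b * d z) * h v z * H v"
      using sgn[of "h v z" "d z" "gdeg d v" a b] by (simp add: mult.assoc)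
  qed
  show ?thesis
    unfolding coderivation_def
  proof (intro conjI allI)
    fix f and z :: 'a and t
    have nn: "ksign (n' * n) = (ksign (n * n') :: 'b)" by (simp add: mult.commute)
    show "ccomm n (cod N d n c) n' (cod N d n' c') f (z # t) =
      ccomm n (cod N d n c) n' (cod N d n' c') (\<lambda>u. f (u @ t)) [z]
      + ksign ((n + n') * d z) * ccomm n (cod N d n c) n' (cod N d n' c') (\<lambda>u. f (z # u)) t"
      unfolding ccomm_def cod_cod_Cons[of N d n c n' c' f z t] cod_cod_Cons[of N d n' c' n c f z t]
        cross[OF c] cross[OF c'] nn
      by (simp add: algebra_simps del: cod.simps)
  qed (simp add: ccomm_def)
qed

lemma ccomm_cod_upd_Nil:
  "ccomm n (cod N d n c) n' (cod N d n' c') (f([] := q)) = ccomm n (cod N d n c) n' (cod N d n' c') f"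
  by (simp add: ccomm_def cod_upd_Nil)

text \<open>Peeling off first letters leads only to slices of \<open>f\<close>, which stay in
  \<open>Sbar d\<close> with the same bound after the value on the empty word is reset;
  \<open>upd\<close> makes that reset harmless.\<close>

lemma coderivation_eq_0:
  fixes d :: "'w::finite \<Rightarrow> int"
  assumes G: "coderivation d k G"
    and upd: "\<And>f. G (f([] := 0)) = G f"
    and one: "\<And>f z. f \<in> Sbar d \<Longrightarrow> bounded_by N f \<Longrightarrow> G f [z] = 0"
    and f: "f \<in> Sbar d" "bounded_by N f"
  shows "G f t = 0"
  using f
proof (induction t arbitrary: f)
  case Nil
  then show ?case by (simp add: coderivation_Nil[OF G])
next
  case (Cons z t)
  have "G (\<lambda>u. f (u @ t)) [z] = G ((\<lambda>u. f ([] @ u @ t))([] := 0)) [z]"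
    by (simp add: upd)
  also have "\<dots> = 0"
    by (rule one[OF Sbar_slice[OF Cons.prems(1)] bounded_by_upd_Nil[OF bounded_by_slice[OF Cons.prems(2)]]])
  finally have 1: "G (\<lambda>u. f (u @ t)) [z] = 0" .
  have "G (\<lambda>u. f (z # u)) t = G ((\<lambda>u. f ([z] @ u @ []))([] := 0)) t"
    by (simp add: upd)
  also have "\<dots> = 0"
    by (rule Cons.IH[OF Sbar_slice[OF Cons.prems(1)] bounded_by_upd_Nil[OF bounded_by_slice[OF Cons.prems(2)]]])
  finally show ?case
    unfolding coderivation_Cons[OF G, of f z t] 1 by simp
qed

text \<open>The square of a degree 1 coderivation is half its graded self-commutator, hence is
  itself governed by one-letter components. Dividing by 2 uses characteristic 0.\<close>

lemma lie_infty_iff: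
  fixes d :: "'w::finite \<Rightarrow> int" and c :: "'w list \<Rightarrow> 'w \<Rightarrow> 'k::field_char_0"
  assumes c: "kernel_degree d 1 c"
  shows "lie_infty d (coder d 1 c) \<longleftrightarrow>
    (\<forall>N. \<forall>f\<in>Sbar d. bounded_by N f \<longrightarrow> (\<forall>w. cod N d 1 c (cod N d 1 c f) [w] = 0))"
proof -
  have sq: "coder d 1 c (coder d 1 c f) = cod N d 1 c (cod N d 1 c f)" if "bounded_by N f" for N f
    unfolding coder_eq_cod[OF that] coder_eq_cod[OF bounded_by_cod[OF that]] ..
  show ?thesis
  proof
    assume "lie_infty d (coder d 1 c)"
    then show "\<forall>N. \<forall>f\<in>Sbar d. bounded_by N f \<longrightarrow> (\<forall>w. cod N d 1 c (cod N d 1 c f) [w] = 0)"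
      unfolding lie_infty_def using sq by metis
  next
    assume R: "\<forall>N. \<forall>f\<in>Sbar d. bounded_by N f \<longrightarrow> (\<forall>w. cod N d 1 c (cod N d 1 c f) [w] = 0)"
    show "lie_infty d (coder d 1 c)"
      unfolding lie_infty_def
    proof (intro ballI ext)
      fix f :: "'w list \<Rightarrow> 'k" and t assume f: "f \<in> Sbar d"
      then obtain N where N: "bounded_by N f" by (auto simp: Sbar_iff)
      let ?G = "ccomm 1 (cod N d 1 c) 1 (cod N d 1 c)"
      have G: "?G f t = 2 * cod N d 1 c (cod N d 1 c f) t" for f t
        by (simp add: ccomm_def ksign_def)
      have "?G f t = 0"
      proof (rule coderivation_eq_0[where G = ?G and N = N])
        show "coderivation d (1 + 1) ?G" by (rule coderivation_ccomm[OF c c])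
        show "?G (h([] := 0)) = ?G h" for h by (rule ccomm_cod_upd_Nil)
        fix h :: "'w list \<Rightarrow> 'k" and z assume "h \<in> Sbar d" "bounded_by N h"
        with R show "?G h [z] = 0" by (simp add: G del: cod.simps)
      qed (fact f N)+
      then show "coder d 1 c (coder d 1 c f) t = 0"
        using G sq[OF N] by simp
    qed
  qed
qed

section \<open>Actions in one-letter components\<close>

lemma cod_singleton: "cod N d n c f [w] = (\<Sum>v\<in>pwords N. f v * c v w)"
  by simp

text \<open>The first letter \<open>z\<close> goes to the far end and the rest of the block then
  passes \<open>c @ [z]\<close>. The letter \<open>z\<close> thus crosses \<open>b\<close> twice,
  and these two signs cancel.\<close>

lemma graded_symmetric_swap:
  assumes "graded_symmetric d f"
  shows "f (b @ c) = ksign (gdeg d b * gdeg d c) * f (c @ b)"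
proof (induction b arbitrary: c)
  case (Cons z b)
  have "f ((z # b) @ c) = f ([] @ z # b @ c)" by simp
  also have "\<dots> = ksign (d z * (gdeg d b + gdeg d c)) * f (b @ c @ [z])"
    using graded_symmetric_move_letter[OF assms, of "[]" z "b @ c" "[]"] by simp
  also have "f (b @ c @ [z]) = ksign (gdeg d b * (gdeg d c + d z)) * f (c @ [z] @ b)"
    using Cons.IH[of "c @ [z]"] by simp
  also have "ksign (d z * (gdeg d b + gdeg d c)) * (ksign (gdeg d b * (gdeg d c + d z)) * f (c @ [z] @ b))
      = ksign (gdeg d (z # b) * gdeg d c) * f (c @ z # b)"
    by (auto simp: ksign_def)
  finally show ?case .
qed simp

lemma rho_at_eq_sum:
  fixes x :: "'e::finite list \<Rightarrow> 'k::comm_ring_1"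
  assumes "bounded_by N x"
  shows "rho_at r x = (\<lambda>b w. \<Sum>a\<in>words N. x a * r a b w)"
proof (intro ext)
  fix b w
  show "rho_at r x b w = (\<Sum>a\<in>words N. x a * r a b w)"
    unfolding rho_at_def
    by (rule sum.mono_neutral_left) (auto dest: bounded_by_nonzero[OF assms])
qed

text \<open>Linearity in the kernel expands the coderivation of \<open>rho_at r x\<close> over words
  \<open>a\<close>; on the support of \<open>x\<close>, homogeneity turns the degree
  \<open>k\<close> into \<open>gdeg dE a\<close>.\<close>

lemma cod_rho_at:
  fixes x :: "'e::finite list \<Rightarrow> 'k::comm_ring_1"
  assumes x: "bounded_by N x" and k: "homogeneous dE k x"
  shows "cod M dV (k + 1) (rho_at r x) g t
    = (\<Sum>a\<in>words N. x a * cod M dV (gdeg dE a + 1) (r a) g t)"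
  unfolding rho_at_eq_sum[OF x] cod_kernel_sum
proof (rule sum.cong[OF refl])
  fix a
  show "x a * cod M dV (k + 1) (r a) g t = x a * cod M dV (gdeg dE a + 1) (r a) g t"
    using k by (cases "x a = 0") (auto simp: homogeneous_def)
qed

lemma kernel_degree_rho_at:
  assumes "\<And>a. kernel_degree dV (gdeg dE a + 1) (r a)" and "homogeneous dE k x"
  shows "kernel_degree dV (k + 1) (rho_at r x)"
  unfolding kernel_degree_def
proof (intro allI impI)
  fix v w assume v: "v \<noteq> []" and "rho_at r x v w \<noteq> 0"
  then obtain a where "x a \<noteq> 0" "x a * r a v w \<noteq> 0"
    unfolding rho_at_def by (auto elim: sum.not_neutral_contains_not_neutral)
  then have "gdeg dE a = k" "r a v w \<noteq> 0"
    using assms(2) by (auto simp: homogeneous_def)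
  then show "dV w = gdeg dV v + (k + 1)"
    using assms(1)[of a] v by (auto simp: kernel_degree_def)
qed

text \<open>A word together with a splitting is the same as a pair of nonempty words, and both parts
  inherit the length bound of \<open>x\<close>.\<close>

lemma sum_over_splits:
  fixes x :: "'e::finite list \<Rightarrow> 'k::comm_ring_1"
  assumes "bounded_by N x"
  shows "(\<Sum>s\<in>{s. x s \<noteq> 0}. \<Sum>(u, v)\<in>{(u, v). s = u @ v \<and> u \<noteq> [] \<and> v \<noteq> []}. x s * H u v)
    = (\<Sum>u\<in>pwords N. \<Sum>v\<in>pwords N. x (u @ v) * H u v)"
proof -
  let ?S = "\<lambda>s::'e list. {(u, v). s = u @ v \<and> u \<noteq> [] \<and> v \<noteq> []}"
  let ?T = "{(u, v). u \<noteq> [] \<and> v \<noteq> [] \<and> x (u @ v) \<noteq> 0}"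
  have T: "?T \<subseteq> pwords N \<times> pwords N"
    using bounded_by_nonzero[OF assms] by (auto simp: words_def pwords_def) (force+)
  have "finite (?S s)" for s
  proof (rule finite_subset)
    show "?S s \<subseteq> words (length s) \<times> words (length s)" by (auto simp: words_def)
  qed simp
  moreover have "finite {s. x s \<noteq> 0}"
    using assms finite_support_iff_bounded_by by blast
  ultimately have "(\<Sum>s\<in>{s. x s \<noteq> 0}. \<Sum>(u, v)\<in>?S s. x s * H u v)
      = (\<Sum>(s, u, v)\<in>Sigma {s. x s \<noteq> 0} ?S. x s * H u v)"
    by (subst sum.Sigma) auto
  also have "\<dots> = (\<Sum>(u, v)\<in>?T. x (u @ v) * H u v)"
    by (rule sum.reindex_bij_witness[of _ "\<lambda>(u, v). (u @ v, u, v)" snd]) auto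
  also have "\<dots> = (\<Sum>(u, v)\<in>pwords N \<times> pwords N. x (u @ v) * H u v)"
    using T by (intro sum.mono_neutral_left) (simp, simp, auto simp: pwords_def)
  finally show ?thesis
    by (simp add: sum.cartesian_product)
qed

text \<open>The one-letter component of \<open>\<Phi>\<^bsub>M x\<^esub> g + \<Sum> \<plusminus> \<Phi>\<^bsub>a\<^esub> (\<Phi>\<^bsub>c\<^esub> g)\<close>, the sum running over the full coproduct
of \<open>x\<close>; the splittings with an empty factor contribute \<open>M\<^sub>V \<Phi>\<^bsub>x\<^esub>\<close> and \<open>\<Phi>\<^bsub>x\<^esub> M\<^sub>V\<close>.\<close>

definition action_defect :: "nat \<Rightarrow> ('e \<Rightarrow> int) \<Rightarrow> ('v \<Rightarrow> int) \<Rightarrow> ('e list \<Rightarrow> 'e \<Rightarrow> 'k::comm_ring_1)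
    \<Rightarrow> ('e list \<Rightarrow> 'v list \<Rightarrow> 'v \<Rightarrow> 'k) \<Rightarrow> int \<Rightarrow> ('e list \<Rightarrow> 'k) \<Rightarrow> ('v list \<Rightarrow> 'k) \<Rightarrow> 'v \<Rightarrow> 'k" where
  "action_defect N dE dV m r k x g w =
     cod N dV (k + 2) (rho_at r (cod N dE 1 m x)) g [w]
     + (\<Sum>a\<in>words N. \<Sum>c\<in>words N. ksign (gdeg dE a) * x (a @ c) *
          cod N dV (gdeg dE a + 1) (r a) (cod N dV (gdeg dE c + 1) (r c) g) [w])"

text \<open>The equation of \<open>is_action\<close> for one pair of tensors, isolated so that a
  length bound can be chosen for that pair.\<close>

definition action_equation :: "('e \<Rightarrow> int) \<Rightarrow> ('v \<Rightarrow> int) \<Rightarrow> ('e list \<Rightarrow> 'e \<Rightarrow> 'k::field_char_0)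
    \<Rightarrow> ('e list \<Rightarrow> 'v list \<Rightarrow> 'v \<Rightarrow> 'k) \<Rightarrow> int \<Rightarrow> ('e list \<Rightarrow> 'k) \<Rightarrow> ('v list \<Rightarrow> 'k) \<Rightarrow> bool" where
  "action_equation dE dV m r k x g \<longleftrightarrow>
     coder dV (k + 2) (rho_at r (coder dE 1 m x)) g =
       (\<lambda>t. - coder dV 1 (r []) (coder dV (k + 1) (rho_at r x) g) t
          + ksign (k + 1) * coder dV (k + 1) (rho_at r x) (coder dV 1 (r []) g) t
          + (1/2) * (\<Sum>s \<in> {s. x s \<noteq> 0}.
               \<Sum>(u, v) \<in> {(u, v). s = u @ v \<and> u \<noteq> [] \<and> v \<noteq> []}.
                 x s * ksign (gdeg dE u + 1) *
                   ccomm (gdeg dE u + 1) (coder dV (gdeg dE u + 1) (r u))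
                     (gdeg dE v + 1) (coder dV (gdeg dE v + 1) (r v)) g t))"

lemma is_action_iff_action_equation:
  "is_action dE dV (coder dE 1 m) (coder dV 1 (r [])) r \<longleftrightarrow>
     (\<forall>k x. x \<in> Sbar dE \<longrightarrow> homogeneous dE k x \<longrightarrow> (\<forall>g\<in>Sbar dV. action_equation dE dV m r k x g))"
  unfolding is_action_def action_equation_def Let_def by blast

text \<open>The difference of the two sides is a coderivation of degree \<open>k + 2\<close>, so its
  one-letter components decide. The quantifier over \<open>g\<close> stands inside each side because
  components on longer words are reduced to slices of \<open>g\<close>.\<close>

lemma action_equation_iff_action_defect:
  fixes dE :: "'e::finite \<Rightarrow> int" and dV :: "'v::finite \<Rightarrow> int"
    and r :: "'e list \<Rightarrow> 'v list \<Rightarrow> 'v \<Rightarrow> 'k::field_char_0"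
  assumes r: "\<And>a. kernel_degree dV (gdeg dE a + 1) (r a)"
    and x: "x \<in> Sbar dE" "homogeneous dE k x" "bounded_by N x"
    and MN: "M \<le> N"
  shows "(\<forall>g\<in>Sbar dV. bounded_by M g \<longrightarrow> action_equation dE dV m r k x g) \<longleftrightarrow>
    (\<forall>g\<in>Sbar dV. bounded_by M g \<longrightarrow> (\<forall>w. action_defect N dE dV m r k x g w = 0))"
proof -
  define \<Phi> where "\<Phi> u = cod N dV (gdeg dE u + 1) (r u)" for u
  define \<Phi>x where "\<Phi>x = cod N dV (k + 1) (rho_at r x)"
  define MV where "MV = cod N dV 1 (r [])"
  define \<Phi>Mx where "\<Phi>Mx = cod N dV (k + 2) (rho_at r (cod N dE 1 m x))"
  define C where "C u v = ccomm (gdeg dE u + 1) (\<Phi> u) (gdeg dE v + 1) (\<Phi> v)" for u v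
  \<comment> \<open>Left side minus right side of the action equation; the differential of \<Phi>x
    is minus its graded commutator with \<open>MV\<close>.\<close>
  define G where "G g t = \<Phi>Mx g t + (ccomm 1 MV (k + 1) \<Phi>x g t +
      (- (1/2)) * (\<Sum>u\<in>pwords N. \<Sum>v\<in>pwords N. x (u @ v) * (ksign (gdeg dE u + 1) * C u v g t)))"
    for g t
  have MV: "MV = \<Phi> []" by (simp add: MV_def \<Phi>_def)
  have eq: "action_equation dE dV m r k x g \<longleftrightarrow> (\<forall>t. G g t = 0)" if g: "bounded_by N g" for g
  proof -
    have coder_g: "coder dV n c g = cod N dV n c g" for n c
      by (rule coder_eq_cod[OF g])
    have coder_cod: "coder dV n c (cod N dV n' c' g) = cod N dV n c (cod N dV n' c' g)" for n c n' c'
      by (rule coder_eq_cod[OF bounded_by_cod[OF g]])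
    have C: "ccomm (gdeg dE u + 1) (coder dV (gdeg dE u + 1) (r u))
        (gdeg dE v + 1) (coder dV (gdeg dE v + 1) (r v)) g t = C u v g t" for u v t
      by (simp only: ccomm_def coder_g coder_cod C_def \<Phi>_def)
    show ?thesis
      unfolding action_equation_def fun_eq_iff G_def coder_eq_cod[OF x(3)] coder_g coder_cod C
        mult.assoc sum_over_splits[OF x(3)]
      unfolding \<Phi>Mx_def[symmetric] \<Phi>x_def[symmetric] MV_def[symmetric] ccomm_def mult_1
      by (intro all_cong1) (auto simp: algebra_simps eq_neg_iff_add_eq_0)
  qed
  have "coderivation dV (k + 2) G"
  proof -
    have "coderivation dV (1 + (k + 1)) (ccomm 1 MV (k + 1) \<Phi>x)"
      unfolding MV_def \<Phi>x_def
      using r[of "[]"] kernel_degree_rho_at[OF r x(2)] by (intro coderivation_ccomm) auto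
    then have c1: "coderivation dV (k + 2) (ccomm 1 MV (k + 1) \<Phi>x)"
      by (simp add: add.commute)
    \<comment> \<open>The degrees of the two factors add up to \<open>k + 2\<close> only where
      \<open>x (u @ v)\<close> is nonzero; the other summands are zero.\<close>
    have c2: "coderivation dV (k + 2) (\<lambda>g t. x (u @ v) * (ksign (gdeg dE u + 1) * C u v g t))" for u v
    proof (cases "x (u @ v) = 0")
      case True
      then show ?thesis by (simp add: coderivation_def)
    next
      case False
      then have "k + 2 = (gdeg dE u + 1) + (gdeg dE v + 1)"
        using x(2) by (auto simp: homogeneous_def)
      then show ?thesis
        by (simp only: C_def \<Phi>_def) (intro coderivation_scale coderivation_ccomm r)
    qed
    show ?thesis
      unfolding G_def[abs_def] \<Phi>Mx_def
      by (intro coderivation_add coderivation_cod c1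
          coderivation_scale[OF coderivation_sum[OF coderivation_sum[OF c2]]])
  qed
  moreover have "G (f([] := 0)) = G f" for f
    unfolding G_def[abs_def] \<Phi>Mx_def \<Phi>x_def MV_def C_def \<Phi>_def
    by (simp only: cod_upd_Nil ccomm_cod_upd_Nil)
  ultimately have G0: "G g t = 0"
    if "\<And>g w. g \<in> Sbar dV \<Longrightarrow> bounded_by M g \<Longrightarrow> G g [w] = 0" "g \<in> Sbar dV" "bounded_by M g" for g t
    using coderivation_eq_0[of dV "k + 2" G M g t] that by blast
  have defect: "G g [w] = action_defect N dE dV m r k x g w" for g w
  proof -
    define P where "P u v = \<Phi> u (\<Phi> v g) [w]" for u v
    have x0: "x [] = 0" and sym: "graded_symmetric dE x" using x(1) by (auto simp: Sbar_iff)
    have \<Phi>x: "\<Phi>x h t = (\<Sum>a\<in>words N. x a * \<Phi> a h t)" for h t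
      unfolding \<Phi>x_def \<Phi>_def by (rule cod_rho_at[OF x(3,2)])
    have 1: "MV (\<Phi>x g) [w] = (\<Sum>a\<in>words N. x a * P [] a)"
    proof -
      have "MV (\<Phi>x g) [w] = MV (\<lambda>t. \<Sum>a\<in>words N. x a * \<Phi> a g t) [w]"
        by (simp only: \<Phi>x[abs_def])
      also have "\<dots> = (\<Sum>a\<in>words N. x a * P [] a)"
        unfolding P_def MV[symmetric] unfolding MV_def by (rule cod_sum)
      finally show ?thesis .
    qed
    have 2: "ksign k * \<Phi>x (MV g) [w] = (\<Sum>a\<in>words N. ksign (gdeg dE a) * x a * P a [])"
      unfolding \<Phi>x sum_distrib_left
    proof (rule sum.cong[OF refl])
      fix a
      show "ksign k * (x a * \<Phi> a (MV g) [w]) = ksign (gdeg dE a) * x a * P a []"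
        using x(2) by (cases "x a = 0") (auto simp: homogeneous_def P_def MV)
    qed
    have "(\<Sum>u\<in>pwords N. \<Sum>v\<in>pwords N. x (u @ v) * (ksign (gdeg dE u + 1) * C u v g [w]))
        = (\<Sum>u\<in>pwords N. \<Sum>v\<in>pwords N. x (u @ v) * ksign (gdeg dE u + 1) * P u v)
        - (\<Sum>u\<in>pwords N. \<Sum>v\<in>pwords N. x (u @ v) * ksign (gdeg dE u + 1)
            * ksign ((gdeg dE u + 1) * (gdeg dE v + 1)) * P v u)"
      unfolding sum_subtractf[symmetric]
      by (simp only: C_def ccomm_def P_def right_diff_distrib mult.assoc)
    also have "(\<Sum>u\<in>pwords N. \<Sum>v\<in>pwords N. x (u @ v) * ksign (gdeg dE u + 1)
            * ksign ((gdeg dE u + 1) * (gdeg dE v + 1)) * P v u)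
        = (\<Sum>u\<in>pwords N. \<Sum>v\<in>pwords N. x (v @ u) * ksign (gdeg dE v + 1)
            * ksign ((gdeg dE v + 1) * (gdeg dE u + 1)) * P u v)"
      by (rule sum.swap)
    also have "\<dots> = - (\<Sum>u\<in>pwords N. \<Sum>v\<in>pwords N. x (u @ v) * ksign (gdeg dE u + 1) * P u v)"
    proof -
      \<comment> \<open>Modulo 2 the exponents, including the one from swapping the blocks
        \<open>u\<close> and \<open>v\<close>, add up to \<open>gdeg dE u\<close>. So the second
        half of the commutator sum repeats the first, and the factor 2 absorbs the 1/2.\<close>
      have "x (v @ u) * ksign (gdeg dE v + 1) * ksign ((gdeg dE v + 1) * (gdeg dE u + 1)) * P u v
          = - (x (u @ v) * ksign (gdeg dE u + 1) * P u v)" for u v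
        unfolding graded_symmetric_swap[OF sym, of v u] by (auto simp: ksign_def)
      then show ?thesis by (simp add: sum_negf)
    qed
    finally have 3: "- (1/2) * (\<Sum>u\<in>pwords N. \<Sum>v\<in>pwords N. x (u @ v) * (ksign (gdeg dE u + 1) * C u v g [w]))
        = (\<Sum>u\<in>pwords N. \<Sum>v\<in>pwords N. ksign (gdeg dE u) * x (u @ v) * P u v)"
      by (simp add: ksign_add ksign_def[of 1] sum_negf mult.commute)
    \<comment> \<open>Splittings with \<open>a\<close> or \<open>c\<close> empty are the two terms
      of the differential; the one with both empty drops out because
      \<open>x [] = 0\<close>.\<close>
    have split: "(\<Sum>a\<in>words N. \<Sum>c\<in>words N. ksign (gdeg dE a) * x (a @ c) * P a c) =
        (\<Sum>a\<in>words N. x a * P [] a) + (\<Sum>a\<in>words N. ksign (gdeg dE a) * x a * P a [])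
        + (\<Sum>u\<in>pwords N. \<Sum>v\<in>pwords N. ksign (gdeg dE u) * x (u @ v) * P u v)"
      by (simp add: sum_words x0 sum.distrib)
    have "ccomm 1 MV (k + 1) \<Phi>x g [w] = MV (\<Phi>x g) [w] + ksign k * \<Phi>x (MV g) [w]"
      by (simp add: ccomm_def ksign_add ksign_def[of 1])
    then show ?thesis
      unfolding G_def 3 1 2 action_defect_def P_def[symmetric] \<Phi>_def[symmetric]
        \<Phi>Mx_def[symmetric] split by (simp add: add.assoc)
  qed
  show ?thesis
    using eq G0 defect bounded_by_mono[OF _ MN] by metis
qed

section \<open>The square of the coderivation on the direct sum\<close>

lemma inj_map_Inl: "inj (map Inl)" and inj_map_Inr: "inj (map Inr)"
  by simp_all

lemma sumdeg_Inl [simp]: "sumdeg dE dV (Inl e) = dE e"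
  and sumdeg_Inr [simp]: "sumdeg dE dV (Inr v) = dV v"
  by (simp_all add: sumdeg_def)

lemma gdeg_map_Inl [simp]: "gdeg (sumdeg dE dV) (map Inl a) = gdeg dE a"
  by (induction a) simp_all

lemma gdeg_map_Inr [simp]: "gdeg (sumdeg dE dV) (map Inr b) = gdeg dV b"
  by (induction b) simp_all

lemma list_all_isl_iff: "list_all isl t \<longleftrightarrow> (\<exists>a. t = map Inl a)"
proof
  assume "list_all isl t"
  then have "t = map Inl (map projl t)"
    by (induction t) auto
  then show "\<exists>a. t = map Inl a" ..
qed (auto simp: list_all_iff)

lemma list_all_not_isl_iff: "list_all (\<lambda>y. \<not> isl y) t \<longleftrightarrow> (\<exists>b. t = map Inr b)"
proof
  assume "list_all (\<lambda>y. \<not> isl y) t"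
  then have "t = map Inr (map projr t)"
    by (induction t) auto
  then show "\<exists>b. t = map Inr b" ..
qed (auto simp: list_all_iff)

section \<open>Support of the kernel \<open>Kmr\<close> and the resulting form of its
  coderivation\<close>

lemma Kmr_Inl_map_Inl: "a \<noteq> [] \<Longrightarrow> Kmr m r (map Inl a) (Inl e) = m a e"
  by (simp add: Kmr_def list_all_iff o_def)

lemma Kmr_Inl_nonzero:
  assumes "Kmr m r t (Inl e) \<noteq> 0"
  obtains a where "t = map Inl a"
  using assms by (auto simp: Kmr_def list_all_isl_iff split: if_splits)

lemma Kmr_Inr_map:
  fixes a :: "'e list" and b :: "'v list"
  assumes "b \<noteq> []"
  shows "Kmr m r (map Inl a @ map Inr b) (Inr w) = r a b w"
proof -
  have "takeWhile isl (map Inl a @ map Inr b) = map Inl a"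
       "dropWhile isl (map Inl a @ map Inr b) = (map Inr b :: ('e + 'v) list)"
    using assms by (auto simp: takeWhile_append dropWhile_append neq_Nil_conv)
  then show ?thesis
    using assms by (simp add: Kmr_def list_all_iff o_def)
qed

lemma Kmr_Inr_nonzero:
  assumes "Kmr m r t (Inr w) \<noteq> 0"
  obtains a b where "b \<noteq> []" "t = map Inl a @ map Inr b"
proof -
  have b: "dropWhile isl t \<noteq> []" "list_all (\<lambda>y. \<not> isl y) (dropWhile isl t)"
    using assms by (auto simp: Kmr_def Let_def split: if_splits)
  then obtain b where "dropWhile isl t = map Inr b"
    using list_all_not_isl_iff by blast
  moreover obtain a where "takeWhile isl t = map Inl a"
    using list_all_isl_iff[of "takeWhile isl t"] by (auto simp: list_all_iff dest: set_takeWhileD)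
  ultimately show thesis
    using that[of b a] b(1) takeWhile_dropWhile_id[of isl t] by auto
qed

lemma kernel_degree_Kmr:
  assumes "kernel_degree dE 1 m" and "\<And>a. kernel_degree dV (gdeg dE a + 1) (r a)"
  shows "kernel_degree (sumdeg dE dV) 1 (Kmr m r)"
  unfolding kernel_degree_def
proof (intro allI impI)
  fix t z assume t: "t \<noteq> []" "Kmr m r t z \<noteq> 0"
  show "sumdeg dE dV z = gdeg (sumdeg dE dV) t + 1"
  proof (cases z)
    case (Inl e)
    then obtain a where "t = map Inl a" using t(2) Kmr_Inl_nonzero by metis
    then show ?thesis
      using t assms(1) Inl by (auto simp: Kmr_Inl_map_Inl kernel_degree_def)
  next
    case (Inr w)
    then obtain a b where "b \<noteq> []" "t = map Inl a @ map Inr b" using t(2) Kmr_Inr_nonzero by metis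
    then show ?thesis
      using t assms(2)[of a] Inr by (auto simp: Kmr_Inr_map kernel_degree_def)
  qed
qed

lemma sum_Kmr_Inl:
  fixes h :: "('e::finite + 'v::finite) list \<Rightarrow> 'k::comm_ring_1"
  shows "(\<Sum>t\<in>pwords N. h t * Kmr m r t (Inl e)) = (\<Sum>a\<in>pwords N. h (map Inl a) * m a e)"
proof -
  have "(\<Sum>t\<in>pwords N. h t * Kmr m r t (Inl e))
      = (\<Sum>t\<in>map Inl ` pwords N. h t * Kmr m r t (Inl e))"
  proof (rule sum.mono_neutral_right)
    show "\<forall>t\<in>pwords N - map Inl ` pwords N. h t * Kmr m r t (Inl e) = 0"
    proof
      fix t :: "('e + 'v) list" assume t: "t \<in> pwords N - map Inl ` pwords N"
      then have "t \<noteq> map Inl a" for a by (auto simp: pwords_def)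
      then have "Kmr m r t (Inl e) = 0" using Kmr_Inl_nonzero by metis
      then show "h t * Kmr m r t (Inl e) = 0" by simp
    qed
    show "map Inl ` pwords N \<subseteq> pwords N" by (auto simp: pwords_def)
  qed simp
  also have "\<dots> = (\<Sum>a\<in>pwords N. h (map Inl a) * m a e)"
    by (subst sum.reindex)
       (auto intro!: sum.cong inj_on_subset[OF inj_map_Inl] simp: Kmr_Inl_map_Inl pwords_def)
  finally show ?thesis .
qed

lemma sum_Kmr_Inr:
  fixes h :: "('e::finite + 'v::finite) list \<Rightarrow> 'k::comm_ring_1"
  assumes h: "bounded_by N h"
  shows "(\<Sum>t\<in>pwords N. h t * Kmr m r t (Inr w))
    = (\<Sum>a\<in>words N. \<Sum>b\<in>pwords N. h (map Inl a @ map Inr b) * r a b w)"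
proof -
  let ?j = "\<lambda>(a :: 'e list, b :: 'v list). map Inl a @ map Inr b"
  let ?S = "words N \<times> pwords N :: ('e list \<times> 'v list) set"
  have inj: "inj_on ?j ?S"
  proof (rule inj_onI, clarify)
    fix a a' :: "'e list" and b b' :: "'v list"
    assume eq: "map Inl a @ map Inr b = map Inl a' @ map Inr b'"
    \<comment> \<open>The two factors of a sorted word are recovered by filtering its
      letters.\<close>
    have "filter isl (map Inl a @ map Inr b) = map Inl a"
      "filter (\<lambda>y. \<not> isl y) (map Inl a @ map Inr b) = map Inr b" for a :: "'e list" and b :: "'v list"
      by (auto simp: filter_map o_def)
    then have "map Inl a = (map Inl a' :: ('e + 'v) list)" "map Inr b = (map Inr b' :: ('e + 'v) list)"
      using eq by metis+
    then show "a = a' \<and> b = b'"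
      using inj_map_Inl inj_map_Inr by (metis injD)
  qed
  have "(\<Sum>t\<in>pwords N. h t * Kmr m r t (Inr w)) = (\<Sum>t\<in>?j ` ?S. h t * Kmr m r t (Inr w))"
  proof (rule sum.mono_neutral_cong)
    fix t :: "('e + 'v) list" assume t: "t \<in> pwords N - ?j ` ?S"
    have "Kmr m r t (Inr w) = 0"
    proof (rule ccontr)
      assume "Kmr m r t (Inr w) \<noteq> 0"
      then obtain a b where ab: "b \<noteq> []" "t = map Inl a @ map Inr b" by (rule Kmr_Inr_nonzero)
      then have "(a, b) \<in> ?S" using t by (auto simp: pwords_def words_def)
      then show False using t ab by (auto simp: image_iff)
    qed
    then show "h t * Kmr m r t (Inr w) = 0" by simp
  next
    \<comment> \<open>Two factors of length at most \<open>N\<close> may concatenate to a word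
      longer than \<open>N\<close>; there \<open>h\<close> vanishes by its bound.\<close>
    fix t assume t: "t \<in> ?j ` ?S - pwords N"
    then have "t \<noteq> []" by (auto simp: pwords_def)
    then have "h t = 0" using t h by (auto simp: pwords_def bounded_by_def)
    then show "h t * Kmr m r t (Inr w) = 0" by simp
  qed simp_all
  also have "\<dots> = (\<Sum>p\<in>?S. h (?j p) * Kmr m r (?j p) (Inr w))"
    by (simp add: sum.reindex[OF inj])
  also have "\<dots> = (\<Sum>(a, b)\<in>?S. h (map Inl a @ map Inr b) * r a b w)"
    by (rule sum.cong) (auto simp: Kmr_Inr_map pwords_def)
  finally show ?thesis by (simp add: sum.cartesian_product)
qed

text \<open>A letter of E in the output can come only from \<open>m\<close>, so on the E-prefix the
  coderivation acts as that of \<open>m\<close> with \<open>t\<close> as a parameter; reaching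
  \<open>t\<close> costs the sign of an operator of degree 1.\<close>

lemma cod_Kmr_append:
  fixes dE :: "'e::finite \<Rightarrow> int" and dV :: "'v::finite \<Rightarrow> int"
  shows "cod N (sumdeg dE dV) 1 (Kmr m r) f (map Inl a @ t)
    = cod N dE 1 m (\<lambda>a'. f (map Inl a' @ t)) a
      + ksign (gdeg dE a) * cod N (sumdeg dE dV) 1 (Kmr m r) (\<lambda>u. f (map Inl a @ u)) t"
proof (induction a arbitrary: f)
  case (Cons e a)
  show ?case
    using Cons.IH[of "\<lambda>u. f (Inl e # u)"] sum_Kmr_Inl[of "\<lambda>v. f (v @ map Inl a @ t)" m r e N]
    by (simp add: ksign_add distrib_left mult.assoc)
qed simp

text \<open>A letter of V in the output comes from an E-word \<open>c\<close> and a V-word. Moving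
  \<open>c\<close> to the front past the preceding V-letters supplies exactly the sign by which the
  degree 1 of the whole kernel becomes the degree \<open>gdeg dE c + 1\<close> of
  \<open>r c\<close>.\<close>

lemma cod_Kmr_map_Inr:
  fixes dE :: "'e::finite \<Rightarrow> int" and dV :: "'v::finite \<Rightarrow> int"
    and f :: "('e + 'v) list \<Rightarrow> 'k::comm_ring_1"
  assumes "graded_symmetric (sumdeg dE dV) f" and "bounded_by N f"
  shows "cod N (sumdeg dE dV) 1 (Kmr m r) f (map Inr b)
    = (\<Sum>c\<in>words N. cod N dV (gdeg dE c + 1) (r c) (\<lambda>b'. f (map Inl c @ map Inr b')) b)"
  using assms
proof (induction b arbitrary: f)
  case (Cons w b)
  have IH: "cod N (sumdeg dE dV) 1 (Kmr m r) (\<lambda>u. f (Inr w # u)) (map Inr b)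
    = (\<Sum>c\<in>words N. cod N dV (gdeg dE c + 1) (r c) (\<lambda>b'. f (Inr w # map Inl c @ map Inr b')) b)"
    using Cons.IH[of "\<lambda>u. f (Inr w # u)"] graded_symmetric_slice[OF Cons.prems(1), of "[Inr w]" "[]"]
      bounded_by_slice[OF Cons.prems(2), of "[Inr w]" "[]"] by simp
  have move: "f (Inr w # map Inl c @ map Inr b')
      = ksign (dV w * gdeg dE c) * f (map Inl c @ Inr w # map Inr b')" for c b'
    using graded_symmetric_move_letter[OF Cons.prems(1), of "[]" "Inr w" "map Inl c" "map Inr b'"]
    by simp
  have sign: "ksign (dV w) * (ksign (dV w * gdeg dE c) * q) = ksign ((gdeg dE c + 1) * dV w) * q" 
    for c and q :: 'k
    by (auto simp: ksign_def)
  have "cod N (sumdeg dE dV) 1 (Kmr m r) f (map Inr (w # b))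
     = (\<Sum>v\<in>pwords N. f (v @ map Inr b) * Kmr m r v (Inr w))
       + ksign (dV w) * cod N (sumdeg dE dV) 1 (Kmr m r) (\<lambda>u. f (Inr w # u)) (map Inr b)"
    by simp
  also have "(\<Sum>v\<in>pwords N. f (v @ map Inr b) * Kmr m r v (Inr w))
      = (\<Sum>c\<in>words N. \<Sum>b'\<in>pwords N. f (map Inl c @ map Inr (b' @ b)) * r c b' w)"
    using sum_Kmr_Inr[of N "\<lambda>v. f (v @ map Inr b)" m r w]
      bounded_by_slice[OF Cons.prems(2), of "[]" "map Inr b"] by simp
  also have "ksign (dV w) * cod N (sumdeg dE dV) 1 (Kmr m r) (\<lambda>u. f (Inr w # u)) (map Inr b)
      = (\<Sum>c\<in>words N. ksign ((gdeg dE c + 1) * dV w)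
           * cod N dV (gdeg dE c + 1) (r c) (\<lambda>b'. f (map Inl c @ map Inr (w # b'))) b)"
    unfolding IH move cod_scale sum_distrib_left sign by simp
  finally show ?case
    by (simp add: sum.distrib)
qed simp

text \<open>The \<open>V\<close>-valued one-letter component of the square of the coderivation; \<open>F\<close> is the restriction
of a symmetric tensor to words in \<open>E\<close> followed by words in \<open>V\<close>.\<close>

definition mixed_defect :: "nat \<Rightarrow> ('e \<Rightarrow> int) \<Rightarrow> ('v \<Rightarrow> int) \<Rightarrow> ('e list \<Rightarrow> 'e \<Rightarrow> 'k::comm_ring_1)
    \<Rightarrow> ('e list \<Rightarrow> 'v list \<Rightarrow> 'v \<Rightarrow> 'k) \<Rightarrow> ('e list \<Rightarrow> 'v list \<Rightarrow> 'k) \<Rightarrow> 'v \<Rightarrow> 'k" where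
  "mixed_defect N dE dV m r F w =
     (\<Sum>a\<in>words N. \<Sum>b\<in>pwords N.
        (cod N dE 1 m (\<lambda>a'. F a' b) a
         + ksign (gdeg dE a) * (\<Sum>c\<in>words N. cod N dV (gdeg dE c + 1) (r c) (F (a @ c)) b)) * r a b w)"

lemma square_Kmr_Inl:
  fixes dE :: "'e::finite \<Rightarrow> int" and dV :: "'v::finite \<Rightarrow> int"
  shows "cod N (sumdeg dE dV) 1 (Kmr m r) (cod N (sumdeg dE dV) 1 (Kmr m r) f) [Inl e]
    = cod N dE 1 m (cod N dE 1 m (\<lambda>a. f (map Inl a))) [e]"
  unfolding cod_singleton sum_Kmr_Inl
  using cod_Kmr_append[of N dE dV m r f _ "[]"] by simp

text \<open>The outer kernel samples the inner result only on sorted words, where it splits into the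
  action of \<open>m\<close> on the E-part and of the maps \<open>r c\<close> on the V-part.\<close>

lemma square_Kmr_Inr:
  fixes dE :: "'e::finite \<Rightarrow> int" and dV :: "'v::finite \<Rightarrow> int"
  assumes sym: "graded_symmetric (sumdeg dE dV) f" and f: "bounded_by N f"
  shows "cod N (sumdeg dE dV) 1 (Kmr m r) (cod N (sumdeg dE dV) 1 (Kmr m r) f) [Inr w]
    = mixed_defect N dE dV m r (\<lambda>a b. f (map Inl a @ map Inr b)) w"
proof -
  have "cod N (sumdeg dE dV) 1 (Kmr m r) (\<lambda>u. f (map Inl a @ u)) (map Inr b)
      = (\<Sum>c\<in>words N. cod N dV (gdeg dE c + 1) (r c) (\<lambda>b'. f (map Inl (a @ c) @ map Inr b')) b)" for a b
    using cod_Kmr_map_Inr[of dE dV "\<lambda>u. f (map Inl a @ u)" N m r b]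
      graded_symmetric_slice[OF sym, of "map Inl a" "[]"] bounded_by_slice[OF f, of "map Inl a" "[]"]
    by simp
  then show ?thesis
    unfolding cod_singleton sum_Kmr_Inr[OF bounded_by_cod[OF f]] cod_Kmr_append mixed_defect_def
    by simp
qed

section \<open>The mixed defect as a linear function of F, and its value on tensors\<close>

lemma mixed_defect_cong:
  assumes "\<And>a b. b \<noteq> [] \<Longrightarrow> F a b = F' a b"
  shows "mixed_defect N dE dV m r F w = mixed_defect N dE dV m r F' w"
proof -
  have "(\<lambda>a'. F a' b) = (\<lambda>a'. F' a' b)" if "b \<in> pwords N" for b
    using that assms by (auto simp: pwords_def)
  moreover have "cod N dV n c (F a) = cod N dV n c (F' a)" for n c a
    by (intro ext cod_cong_nonempty assms)
  ultimately show ?thesis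
    unfolding mixed_defect_def by (auto intro!: sum.cong)
qed

lemma mixed_defect_add:
  "mixed_defect N dE dV m r (\<lambda>a b. F a b + F' a b) w
    = mixed_defect N dE dV m r F w + mixed_defect N dE dV m r F' w"
  unfolding mixed_defect_def cod_add sum.distrib[symmetric]
  by (intro sum.cong refl) (simp add: sum.distrib algebra_simps)

lemma mixed_defect_zero: "mixed_defect N dE dV m r (\<lambda>a b. 0) w = 0"
  unfolding mixed_defect_def cod_zero by simp

text \<open>On a tensor the E-operations act on \<open>x\<close> and the V-operations on
  \<open>g\<close>; interchanging finite sums gives the defect. \<open>k\<close> can be chosen
  freely since the degree of a coderivation gives no sign on a one-letter word.\<close>

lemma mixed_defect_tensor:
  fixes x :: "'e::finite list \<Rightarrow> 'k::comm_ring_1" and g :: "'v::finite list \<Rightarrow> 'k"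
  assumes "bounded_by N x"
  shows "mixed_defect N dE dV m r (\<lambda>a b. x a * g b) w = action_defect N dE dV m r k x g w"
proof -
  have "(\<Sum>a\<in>words N. \<Sum>b\<in>pwords N. cod N dE 1 m (\<lambda>a'. x a' * g b) a * r a b w)
      = cod N dV (k + 2) (rho_at r (cod N dE 1 m x)) g [w]"
    unfolding cod_singleton rho_at_eq_sum[OF bounded_by_cod[OF assms]] sum_distrib_left
    by (subst sum.swap) (simp add: cod_scale mult_ac flip: mult.commute[of "g _"])
  moreover have "(\<Sum>b\<in>pwords N. ksign (gdeg dE a)
        * (\<Sum>c\<in>words N. cod N dV (gdeg dE c + 1) (r c) (\<lambda>b'. x (a @ c) * g b') b) * r a b w)
      = (\<Sum>c\<in>words N. ksign (gdeg dE a) * x (a @ c) *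
          cod N dV (gdeg dE a + 1) (r a) (cod N dV (gdeg dE c + 1) (r c) g) [w])" for a
    unfolding cod_singleton cod_scale sum_distrib_left sum_distrib_right
    by (subst sum.swap) (simp add: mult_ac)
  ultimately show ?thesis
    unfolding mixed_defect_def action_defect_def distrib_right sum.distrib by simp
qed

text \<open>A multiple of the unit of S(E) is split by the full coproduct only into empty factors,
  which leaves the square of the curvature coderivation.\<close>

lemma action_defect_scalar:
  fixes dE :: "'e::finite \<Rightarrow> int"
  assumes "\<And>a. a \<noteq> [] \<Longrightarrow> x a = 0"
  shows "action_defect N dE dV m r k x g w
    = x [] * cod N dV 1 (r []) (cod N dV 1 (r []) g) [w]"
proof -
  have "cod N dE 1 m x = (\<lambda>_. 0)"
    using cod_cong_nonempty[of x "\<lambda>_. 0" N dE 1 m] assms cod_zero[of N dE 1 m] by auto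
  then have "cod N dV (k + 2) (rho_at r (cod N dE 1 m x)) g [w] = 0"
    by (simp add: rho_at_def)
  moreover have "x a = 0" and "x (a @ c) = 0" if "a \<in> pwords N" for a c
    using that by (auto intro!: assms)
  ultimately show ?thesis
    unfolding action_defect_def sum_words by (simp del: cod.simps cong: sum.cong_simp)
qed

section \<open>Symmetric tensors on the direct sum\<close>

text \<open>\<^term>\<open>shuffle_sign dE dV t\<close> is the Koszul sign of moving all letters of \<^term>\<open>t\<close> in \<open>E\<close> in front
of those in \<open>V\<close>.\<close>

definition lefts :: "('e + 'v) list \<Rightarrow> 'e list" where
  "lefts t = map projl (filter isl t)"

definition rights :: "('e + 'v) list \<Rightarrow> 'v list" where
  "rights t = map projr (filter (\<lambda>y. \<not> isl y) t)"

fun shuffle_sign :: "('e \<Rightarrow> int) \<Rightarrow> ('v \<Rightarrow> int) \<Rightarrow> ('e + 'v) list \<Rightarrow> 'k::comm_ring_1" where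
  "shuffle_sign dE dV [] = 1"
| "shuffle_sign dE dV (Inl e # t) = shuffle_sign dE dV t"
| "shuffle_sign dE dV (Inr v # t) = ksign (dV v * gdeg dE (lefts t)) * shuffle_sign dE dV t"

text \<open>For symmetric \<open>x\<close> and \<open>g\<close>, the symmetric tensor corresponding
  to their product under the isomorphism of S(E) \<otimes> S(V) with S(E \<oplus> V).\<close>

definition sym_tensor :: "('e \<Rightarrow> int) \<Rightarrow> ('v \<Rightarrow> int) \<Rightarrow> ('e list \<Rightarrow> 'k::comm_ring_1) \<Rightarrow> ('v list \<Rightarrow> 'k)
    \<Rightarrow> ('e + 'v) list \<Rightarrow> 'k" where
  "sym_tensor dE dV x g t = shuffle_sign dE dV t * x (lefts t) * g (rights t)"

lemma lefts_append [simp]: "lefts (s @ t) = lefts s @ lefts t"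
  and rights_append [simp]: "rights (s @ t) = rights s @ rights t"
  and lefts_Inl [simp]: "lefts (Inl e # t) = e # lefts t"
  and lefts_Inr [simp]: "lefts (Inr v # t) = lefts t"
  and rights_Inl [simp]: "rights (Inl e # t) = rights t"
  and rights_Inr [simp]: "rights (Inr v # t) = v # rights t"
  and lefts_Nil [simp]: "lefts [] = []" and rights_Nil [simp]: "rights [] = []"
  by (simp_all add: lefts_def rights_def)

lemma lefts_rights_map [simp]:
  "lefts (map Inl a) = a" "lefts (map Inr b) = []" "rights (map Inl a) = []" "rights (map Inr b) = b"
  by (induction a; induction b; simp)+

lemma length_lefts_rights: "length (lefts t) + length (rights t) = length t"
  unfolding lefts_def rights_def using sum_length_filter_compl[of isl t] by simp

lemma shuffle_sign_sorted: "shuffle_sign dE dV (map Inl a @ map Inr b) = 1"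
proof (induction a)
  case Nil
  show ?case by (induction b) auto
qed simp

lemma sym_tensor_sorted: "sym_tensor dE dV x g (map Inl a @ map Inr b) = x a * g b"
  by (simp add: sym_tensor_def shuffle_sign_sorted)

lemma shuffle_sign_transpose:
  "shuffle_sign dE dV (u @ a # b # v) =
     (if isl a = isl b then 1 else ksign (sumdeg dE dV a * sumdeg dE dV b))
       * (shuffle_sign dE dV (u @ b # a # v) :: 'k::comm_ring_1)"
proof (induction u)
  case Nil
  show ?case
    by (cases a; cases b) (auto simp: ksign_def)
next
  case (Cons z u)
  \<comment> \<open>A V-letter of the prefix sees only the total degree of the E-letters to its
    right, which the transposition preserves.\<close>
  have "gdeg dE (lefts (u @ a # b # v)) = gdeg dE (lefts (u @ b # a # v))"
    by (cases a; cases b) auto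
  then show ?case
    using Cons.IH by (cases z) (auto simp del: lefts_append simp: mult.left_commute)
qed

text \<open>Exchanging two letters of the same kind takes its sign from \<open>x\<close> or
  \<open>g\<close>; exchanging letters of different kinds takes it from the shuffle sign.\<close>

lemma graded_symmetric_sym_tensor:
  fixes x :: "'e list \<Rightarrow> 'k::comm_ring_1" and g :: "'v list \<Rightarrow> 'k"
  assumes x: "graded_symmetric dE x" and g: "graded_symmetric dV g"
  shows "graded_symmetric (sumdeg dE dV) (sym_tensor dE dV x g)"
  unfolding graded_symmetric_def
proof (intro allI)
  fix u a b v
  note s = shuffle_sign_transpose[of dE dV u a b v, where 'k = 'k]
  show "sym_tensor dE dV x g (u @ a # b # v)
      = ksign (sumdeg dE dV a * sumdeg dE dV b) * sym_tensor dE dV x g (u @ b # a # v)"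
  proof (cases a; cases b)
    fix e e' assume "a = Inl e" "b = Inl e'"
    then show ?thesis
      using s graded_symmetricD[OF x, of "lefts u" e e' "lefts v"]
      by (simp add: sym_tensor_def mult_ac)
  next
    fix w w' assume "a = Inr w" "b = Inr w'"
    then show ?thesis
      using s graded_symmetricD[OF g, of "rights u" w w' "rights v"]
      by (simp add: sym_tensor_def mult_ac)
  qed (use s in \<open>simp_all add: sym_tensor_def mult_ac\<close>)
qed

lemma bounded_by_sym_tensor:
  assumes "bounded_by M x" and "bounded_by N g"
  shows "bounded_by (M + N) (sym_tensor dE dV x g)"
  unfolding bounded_by_def
proof (intro allI impI)
  fix t :: "('a + 'c) list" assume "M + N < length t"
  then have "M < length (lefts t) \<or> N < length (rights t)"
    using length_lefts_rights[of t] by linarith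
  then show "sym_tensor dE dV x g t = 0"
    using assms by (auto simp: bounded_by_def sym_tensor_def)
qed

text \<open>The condition on the empty words permits one factor to be the unit tensor, so pure
  E-tensors and pure V-tensors are covered too.\<close>

lemma sym_tensor_in_Sbar:
  fixes dE :: "'e::finite \<Rightarrow> int" and dV :: "'v::finite \<Rightarrow> int"
  assumes "graded_symmetric dE x" "bounded_by M x" "graded_symmetric dV g" "bounded_by N g"
    and "x [] * g [] = 0"
  shows "sym_tensor dE dV x g \<in> Sbar (sumdeg dE dV)"
  unfolding Sbar_iff
  using graded_symmetric_sym_tensor[OF assms(1,3)] bounded_by_sym_tensor[OF assms(2,4)] assms(5)
  by (auto simp: sym_tensor_def mult.assoc)

text \<open>Subtracting from \<open>F\<close> the rank-one function built from the row and the column through a nonzero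
entry clears that column (restricted to one value of \<open>\<kappa>\<close>) and fills no zero column.\<close>

lemma rank_one_induct:
  fixes F :: "'a \<Rightarrow> 'b \<Rightarrow> 'k::field" and \<kappa> :: "'a \<Rightarrow> 'i"
  assumes "finite {(a, b). F a b \<noteq> 0}"
    and "\<And>b. (\<lambda>a. F a b) \<in> X" and "\<And>a. F a \<in> Y"
    and X: "\<And>x y q. x \<in> X \<Longrightarrow> y \<in> X \<Longrightarrow> (\<lambda>a. x a - q * y a) \<in> X"
    and X\<kappa>: "\<And>x j q. x \<in> X \<Longrightarrow> (\<lambda>a. if \<kappa> a = j then q * x a else 0) \<in> X"
    and Y: "\<And>g h q. g \<in> Y \<Longrightarrow> h \<in> Y \<Longrightarrow> (\<lambda>b. g b - q * h b) \<in> Y"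
    and zero: "P (\<lambda>a b. 0)"
    and step: "\<And>G x g j. P G \<Longrightarrow> x \<in> X \<Longrightarrow> (\<And>a. x a \<noteq> 0 \<Longrightarrow> \<kappa> a = j) \<Longrightarrow> g \<in> Y
      \<Longrightarrow> P (\<lambda>a b. G a b + x a * g b)"
  shows "P F"
  using assms(1-3)
proof (induction "card ((\<lambda>(a, b). (\<kappa> a, b)) ` {(a, b). F a b \<noteq> 0})" arbitrary: F rule: less_induct)
  case less
  let ?supp = "\<lambda>F. (\<lambda>(a, b). (\<kappa> a, b)) ` {(a, b). F a b \<noteq> 0}"
  show ?case
  proof (cases "\<forall>a b. F a b = 0")
    case True
    then have "F = (\<lambda>a b. 0)" by auto
    then show ?thesis using zero by simp
  next
    case False
    then obtain a0 b0 where nz: "F a0 b0 \<noteq> 0" by auto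
    \<comment> \<open>The column through the nonzero entry, restricted to the class of
      \<open>a0\<close> and scaled so that \<open>x a0 = 1\<close>.\<close>
    define x where "x a = (if \<kappa> a = \<kappa> a0 then inverse (F a0 b0) * F a b0 else 0)" for a
    define G where "G a b = F a b - x a * F a0 b" for a b
    have x: "x \<in> X"
      unfolding x_def[abs_def] by (rule X\<kappa>[OF less.prems(2)])
    \<comment> \<open>A column of \<open>G\<close> can gain an entry only in the class of
      \<open>a0\<close> and only where row \<open>a0\<close> is nonzero, so that pair of class and
      column was counted already.\<close>
    have sub: "?supp G \<subseteq> ?supp F - {(\<kappa> a0, b0)}"
    proof clarify
      fix a b assume ab: "G a b \<noteq> 0"
      have "(\<kappa> a, b) \<in> ?supp F"
      proof (cases "F a b = 0")
        case True
        then have "\<kappa> a = \<kappa> a0" "F a0 b \<noteq> 0"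
          using ab by (auto simp: G_def x_def split: if_splits)
        then show ?thesis by force
      qed force
      moreover have "(\<kappa> a, b) \<noteq> (\<kappa> a0, b0)"
        using ab nz by (auto simp: G_def x_def)
      ultimately show "(\<kappa> a, b) \<in> ?supp F - {(\<kappa> a0, b0)}" by blast
    qed
    have mem: "(\<kappa> a0, b0) \<in> ?supp F" using nz by force
    have finF: "finite (?supp F)" using less.prems(1) by (rule finite_imageI)
    have "{(a, b). G a b \<noteq> 0} \<subseteq>
        {(a, b). F a b \<noteq> 0} \<union> (fst ` {(a, b). F a b \<noteq> 0}) \<times> (snd ` {(a, b). F a b \<noteq> 0})"
      by (force simp: G_def x_def split: if_splits)
    then have finG: "finite {(a, b). G a b \<noteq> 0}"
      by (rule finite_subset) (use less.prems(1) in auto)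
    have "P G"
    proof (rule less.hyps[OF _ finG])
      have "?supp G \<subset> ?supp F" using sub mem by blast
      then show "card (?supp G) < card (?supp F)" by (rule psubset_card_mono[OF finF])
      show "(\<lambda>a. G a b) \<in> X" for b
        unfolding G_def using X[OF less.prems(2) x, of b "F a0 b"] by (simp add: mult.commute)
      show "G a \<in> Y" for a
        unfolding G_def[abs_def] by (rule Y[OF less.prems(3,3)])
    qed
    then have "P (\<lambda>a b. G a b + x a * F a0 b)"
      by (rule step[OF _ x _ less.prems(3)]) (auto simp: x_def split: if_splits)
    then show ?thesis by (simp add: G_def)
  qed
qed

section \<open>The equivalence\<close>

text \<open>By \<open>rank_one_induct\<close>, F is built from tensors whose first factor is
  homogeneous and either a multiple of the unit or an element of \<open>Sbar dE\<close>. The former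
  are settled by \<open>curv\<close>, the latter by \<open>act\<close>.\<close>

lemma mixed_defect_eq_0:
  fixes dE :: "'e::finite \<Rightarrow> int" and dV :: "'v::finite \<Rightarrow> int"
    and r :: "'e list \<Rightarrow> 'v list \<Rightarrow> 'v \<Rightarrow> 'k::field_char_0"
  assumes F: "finite {(a, b). F a b \<noteq> 0}"
    and cols: "\<And>b. graded_symmetric dE (\<lambda>a. F a b)" "\<And>b. bounded_by N (\<lambda>a. F a b)"
    and rows: "\<And>a. F a \<in> Sbar dV" "\<And>a. bounded_by N (F a)"
    and curv: "\<And>g w. g \<in> Sbar dV \<Longrightarrow> bounded_by N g \<Longrightarrow>
      cod N dV 1 (r []) (cod N dV 1 (r []) g) [w] = 0"
    and act: "\<And>k x g w. x \<in> Sbar dE \<Longrightarrow> homogeneous dE k x \<Longrightarrow> bounded_by N x \<Longrightarrow>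
      g \<in> Sbar dV \<Longrightarrow> bounded_by N g \<Longrightarrow> action_defect N dE dV m r k x g w = 0"
  shows "mixed_defect N dE dV m r F w = 0"
proof -
  let ?X = "{x. graded_symmetric dE x \<and> bounded_by N x}"
  let ?Y = "{g \<in> Sbar dV. bounded_by N g}"
  have sym_restrict: "graded_symmetric dE (\<lambda>a. if (gdeg dE a, a = []) = j then q * x a else 0)"
    if x: "graded_symmetric dE x" for x :: "'e list \<Rightarrow> 'k" and q j
    unfolding graded_symmetric_def
  proof (intro allI)
    fix u a b v
    show "(if (gdeg dE (u @ a # b # v), u @ a # b # v = []) = j then q * x (u @ a # b # v) else 0)
        = ksign (dE a * dE b) *
          (if (gdeg dE (u @ b # a # v), u @ b # a # v = []) = j then q * x (u @ b # a # v) else 0)"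
      using graded_symmetricD[OF x, of u a b v] by (simp add: algebra_simps)
  qed
  show ?thesis
  \<comment> \<open>The flag \<open>a = []\<close> accompanies the degree because nonempty words may
    also have degree 0.\<close>
  proof (rule rank_one_induct[where F = F and X = ?X and Y = ?Y and \<kappa> = "\<lambda>a. (gdeg dE a, a = [])"
        and P = "\<lambda>F. mixed_defect N dE dV m r F w = 0"])
    fix G and x :: "'e list \<Rightarrow> 'k" and g :: "'v list \<Rightarrow> 'k" and j
    assume G: "mixed_defect N dE dV m r G w = 0" and x: "x \<in> ?X" and g: "g \<in> ?Y"
      and j: "\<And>a. x a \<noteq> 0 \<Longrightarrow> (gdeg dE a, a = []) = j"
    have "action_defect N dE dV m r (fst j) x g w = 0"
    proof (cases "snd j")
      case True
      then have "x a = 0" if "a \<noteq> []" for a using j[of a] that by (cases j) auto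
      then show ?thesis using curv[of g w] g by (simp add: action_defect_scalar del: cod.simps)
    next
      case False
      then have "x [] = 0" using j[of "[]"] by (cases j) auto
      moreover have "homogeneous dE (fst j) x" using j by (fastforce simp: homogeneous_def)
      ultimately show ?thesis using x g by (intro act) (auto simp: Sbar_iff)
    qed
    then have "mixed_defect N dE dV m r (\<lambda>a b. x a * g b) w = 0"
      using mixed_defect_tensor[of N x dE dV m r g w "fst j"] x by simp
    then show "mixed_defect N dE dV m r (\<lambda>a b. G a b + x a * g b) w = 0"
      using G by (simp add: mixed_defect_add)
  next
    show "(\<lambda>b. g b - q * h b) \<in> ?Y" if "g \<in> ?Y" "h \<in> ?Y" for g h :: "'v list \<Rightarrow> 'k" and q
    proof -
      have "bounded_by N (\<lambda>b. g b - q * h b)"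
        using that by (auto simp: bounded_by_def)
      then show ?thesis using that graded_symmetric_diff[of dV g h q] by (auto simp: Sbar_iff)
    qed
  next
    show "(\<lambda>a. x a - q * y a) \<in> ?X" if "x \<in> ?X" "y \<in> ?X" for x y :: "'e list \<Rightarrow> 'k" and q
      using that graded_symmetric_diff[of dE x y q] by (auto simp: bounded_by_def)
  next
    show "(\<lambda>a. if (gdeg dE a, a = []) = j then q * x a else 0) \<in> ?X" if "x \<in> ?X"
      for x :: "'e list \<Rightarrow> 'k" and j q
      using that sym_restrict[of x j q] by (auto simp: bounded_by_def)
  qed (use assms mixed_defect_zero in auto)
qed

theorem mainTheorem12:
  fixes dE :: "'e::finite \<Rightarrow> int" and dV :: "'v::finite \<Rightarrow> int"
    and m :: "'e list \<Rightarrow> 'e \<Rightarrow> 'k::field_char_0"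
    and r :: "'e list \<Rightarrow> 'v list \<Rightarrow> 'v \<Rightarrow> 'k"
  assumes deg_m: "\<forall>a e. a \<noteq> [] \<longrightarrow> m a e \<noteq> 0 \<longrightarrow> dE e = gdeg dE a + 1"
    and deg_r: "\<forall>a b w. b \<noteq> [] \<longrightarrow> r a b w \<noteq> 0 \<longrightarrow> dV w = gdeg dE a + gdeg dV b + 1"
  shows "(\<forall>f \<in> Sbar (sumdeg dE dV).
            ccomm 1 (coder (sumdeg dE dV) 1 (Kmr m r)) 1 (coder (sumdeg dE dV) 1 (Kmr m r)) f
              = (\<lambda>_. 0))
         \<longleftrightarrow> lie_infty dE (coder dE 1 m)
           \<and> lie_infty dV (coder dV 1 (r []))
           \<and> is_action dE dV (coder dE 1 m) (coder dV 1 (r [])) r"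
proof -
  let ?D = "sumdeg dE dV"
  let ?Q = "\<lambda>N. cod N ?D 1 (Kmr m r)"
  \<comment> \<open>The unit of S(E) or S(V).\<close>
  let ?\<delta> = "\<lambda>u. if u = [] then 1 else 0"
  have m: "kernel_degree dE 1 m" using deg_m by (auto simp: kernel_degree_def)
  have r: "kernel_degree dV (gdeg dE a + 1) (r a)" for a
    using deg_r by (auto simp: kernel_degree_def)
  have r0: "kernel_degree dV 1 (r [])" using r[of "[]"] by simp
  have \<delta>: "graded_symmetric d (?\<delta> :: 'w list \<Rightarrow> 'k)" "bounded_by 0 (?\<delta> :: 'w list \<Rightarrow> 'k)"
    for d :: "'w \<Rightarrow> int"
    by (auto simp: graded_symmetric_def bounded_by_def)
  have double: "ccomm 1 Q 1 Q f = (\<lambda>t. 2 * Q (Q f) t)" for Q :: "('w list \<Rightarrow> 'k) \<Rightarrow> 'w list \<Rightarrow> 'k" and f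
    by (simp add: ccomm_def ksign_def)
  have "(\<forall>f \<in> Sbar ?D. ccomm 1 (coder ?D 1 (Kmr m r)) 1 (coder ?D 1 (Kmr m r)) f = (\<lambda>_. 0))
      \<longleftrightarrow> lie_infty ?D (coder ?D 1 (Kmr m r))"
    unfolding lie_infty_def double by (simp add: fun_eq_iff)
  also have "\<dots> \<longleftrightarrow> (\<forall>N. \<forall>f\<in>Sbar ?D. bounded_by N f \<longrightarrow> (\<forall>z. ?Q N (?Q N f) [z] = 0))"
    by (rule lie_infty_iff[OF kernel_degree_Kmr[OF m r]])
  also have "\<dots> \<longleftrightarrow> lie_infty dE (coder dE 1 m) \<and> lie_infty dV (coder dV 1 (r []))
           \<and> is_action dE dV (coder dE 1 m) (coder dV 1 (r [])) r" (is "?L \<longleftrightarrow> ?R")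
  proof
    assume L: ?L
    \<comment> \<open>The vanishing square is tested on the symmetric extension of the tensor of
      \<open>x\<close> and \<open>g\<close>; lengths add, hence the bound
      \<open>M + M'\<close>.\<close>
    have defect: "action_defect N dE dV m r k x g w = 0"
      if "graded_symmetric dE x" "bounded_by M x" "graded_symmetric dV g" "bounded_by M' g"
        "x [] * g [] = 0" "N = M + M'" for N M M' k x g w
    proof -
      have "mixed_defect N dE dV m r (\<lambda>a b. sym_tensor dE dV x g (map Inl a @ map Inr b)) w = 0"
        using L sym_tensor_in_Sbar[OF that(1-5)] bounded_by_sym_tensor[OF that(2,4)] that(6)
        by (subst square_Kmr_Inr[symmetric]) (auto simp: Sbar_iff)
      then show ?thesis
        using mixed_defect_tensor[of N x dE dV m r g w k] bounded_by_mono[OF that(2), of N] that(6)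
        by (simp add: sym_tensor_sorted)
    qed
    have "lie_infty dE (coder dE 1 m)"
      unfolding lie_infty_iff[OF m]
    proof (intro allI ballI impI)
      fix N and x :: "'e list \<Rightarrow> 'k" and e assume x: "x \<in> Sbar dE" "bounded_by N x"
      \<comment> \<open>Pairing with the unit of S(V) extends \<open>x\<close> by zero to words
        containing a V-letter.\<close>
      have "sym_tensor dE dV x ?\<delta> \<in> Sbar ?D" "bounded_by N (sym_tensor dE dV x ?\<delta>)"
        using x \<delta>(1)[of dV] \<delta>(2) sym_tensor_in_Sbar[of dE x N dV ?\<delta> 0]
          bounded_by_sym_tensor[of N x 0 ?\<delta> dE dV]
        by (auto simp: Sbar_iff)
      then have "?Q N (?Q N (sym_tensor dE dV x ?\<delta>)) [Inl e] = 0"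
        using L by blast
      then show "cod N dE 1 m (cod N dE 1 m x) [e] = 0"
        using sym_tensor_sorted[of dE dV x ?\<delta> _ "[]"] by (simp add: square_Kmr_Inl del: cod.simps)
    qed
    moreover have "lie_infty dV (coder dV 1 (r []))"
      unfolding lie_infty_iff[OF r0]
    proof (intro allI ballI impI)
      fix N and g :: "'v list \<Rightarrow> 'k" and w assume g: "g \<in> Sbar dV" "bounded_by N g"
      then have "action_defect N dE dV m r 0 ?\<delta> g w = 0"
        using \<delta>(1)[of dE] \<delta>(2) by (intro defect) (auto simp: Sbar_iff)
      then show "cod N dV 1 (r []) (cod N dV 1 (r []) g) [w] = 0"
        using action_defect_scalar[of ?\<delta> N dE dV m r 0 g w] by (simp del: cod.simps)
    qed
    moreover have "is_action dE dV (coder dE 1 m) (coder dV 1 (r [])) r"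
      unfolding is_action_iff_action_equation
    proof (intro allI ballI impI)
      fix k and x :: "'e list \<Rightarrow> 'k" and g :: "'v list \<Rightarrow> 'k"
      assume x: "x \<in> Sbar dE" "homogeneous dE k x" and g: "g \<in> Sbar dV"
      from x(1) g obtain M M' where M: "bounded_by M x" "bounded_by M' g" by (auto simp: Sbar_iff)
      have "\<forall>g\<in>Sbar dV. bounded_by M' g \<longrightarrow> (\<forall>w. action_defect (M + M') dE dV m r k x g w = 0)"
        using x(1) M(1) by (auto simp: Sbar_iff intro: defect)
      then show "action_equation dE dV m r k x g"
        using action_equation_iff_action_defect[OF r x bounded_by_mono[OF M(1), of "M + M'"], of M'] g M(2)
        by auto
    qed
    ultimately show ?R by blast
  next
    assume R: ?R
    show ?L
    proof (intro allI ballI impI)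
      fix N and f :: "('e + 'v) list \<Rightarrow> 'k" and z assume f: "f \<in> Sbar ?D" "bounded_by N f"
      then have sym: "graded_symmetric ?D f" and f0: "f [] = 0" by (auto simp: Sbar_iff)
      have cols: "graded_symmetric dE (\<lambda>a. f (map Inl a @ map Inr b))" for b
        unfolding graded_symmetric_def
      proof (intro allI)
        fix u e e' v
        show "f (map Inl (u @ e # e' # v) @ map Inr b)
            = ksign (dE e * dE e') * f (map Inl (u @ e' # e # v) @ map Inr b)"
          using graded_symmetricD[OF sym, of "map Inl u" "Inl e" "Inl e'" "map Inl v @ map Inr b"] by simp
      qed
      have rows: "graded_symmetric dV (\<lambda>b. f (map Inl a @ map Inr b))" for a
        unfolding graded_symmetric_def
      proof (intro allI)
        fix u w w' v
        show "f (map Inl a @ map Inr (u @ w # w' # v))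
            = ksign (dV w * dV w') * f (map Inl a @ map Inr (u @ w' # w # v))"
          using graded_symmetricD[OF sym, of "map Inl a @ map Inr u" "Inr w" "Inr w'" "map Inr v"] by simp
      qed
      show "?Q N (?Q N f) [z] = 0"
      proof (cases z)
        case (Inl e)
        have bnd: "bounded_by N (\<lambda>a. f (map Inl a))" using f(2) by (simp add: bounded_by_def)
        moreover have "(\<lambda>a. f (map Inl a)) \<in> Sbar dE"
          using cols[of "[]"] bnd f0 by (auto simp: Sbar_iff)
        ultimately show ?thesis
          using R Inl unfolding lie_infty_iff[OF m] by (simp add: square_Kmr_Inl del: cod.simps)
      next
        case (Inr w)
        \<comment> \<open>Clearing the entries with empty V-part puts the rows into
          \<open>Sbar dV\<close>; the mixed defect is unchanged, as it reads only nonempty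
          V-words.\<close>
        define F where "F a b = (if b = [] then 0 else f (map Inl a @ map Inr b))" for a b
        have F_row: "F a = (\<lambda>b. f (map Inl a @ map Inr b))([] := 0)" for a
          by (auto simp: F_def)
        have "mixed_defect N dE dV m r F w = 0"
        proof (rule mixed_defect_eq_0)
          have "{(a, b). F a b \<noteq> 0} \<subseteq> words N \<times> words N"
            using f(2) by (force simp: F_def bounded_by_def words_def split: if_splits)
          then show "finite {(a, b). F a b \<noteq> 0}" by (rule finite_subset) simp
          show "graded_symmetric dE (\<lambda>a. F a b)" for b
            using cols[of b] by (cases "b = []") (simp_all only: F_def if_True if_False, simp add: graded_symmetric_def)
          show "bounded_by N (\<lambda>a. F a b)" for b
            using f(2) by (auto simp: bounded_by_def F_def)
          show bnd: "bounded_by N (F a)" for a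
            using f(2) by (auto simp: bounded_by_def F_def)
          show "F a \<in> Sbar dV" for a
            using bnd[of a] graded_symmetric_upd_Nil[OF rows[of a], of 0]
            by (auto simp: Sbar_iff F_row)
          show "cod N dV 1 (r []) (cod N dV 1 (r []) g) [w] = 0"
            if "g \<in> Sbar dV" "bounded_by N g" for g w
            using R that unfolding lie_infty_iff[OF r0] by blast
          show "action_defect N dE dV m r k x g w = 0"
            if "x \<in> Sbar dE" "homogeneous dE k x" "bounded_by N x" "g \<in> Sbar dV" "bounded_by N g"
            for k x g w
            using R that action_equation_iff_action_defect[OF r that(1-3) order_refl, of m]
            unfolding is_action_iff_action_equation by blast
        qed
        also have "mixed_defect N dE dV m r F w
            = mixed_defect N dE dV m r (\<lambda>a b. f (map Inl a @ map Inr b)) w"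
          by (rule mixed_defect_cong) (simp add: F_def)
        finally show ?thesis
          using square_Kmr_Inr[OF sym f(2)] Inr by simp
      qed
    qed
  qed
  finally show ?thesis .
qed

end
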